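(* Assume $MA(\omega_1)$. Then there is no wide Aronszajn tree which is universal under weak embeddings; that is, there is no wide Aronszajn tree $U$ such that every wide Aronszajn tree weakly embeds into $U$.
   Context: A wide Aronszajn tree is a tree of height $\omega_1$ and cardinality $\aleph_1$ with no uncountable branch. A weak embedding from $T_1$ to $T_2$ is a map $f:T_1\to T_2$ with $x<_{T_1}y\Rightarrow f(x)<_{T_2}f(y)$. $MA(\omega_1)$ is Martin's Axiom for $\aleph_1$ dense sets. *)

theory Defs
  imports Main "HOL-Library.Countable_Set"
begin

definition pred_set :: "'a set \<Rightarrow> ('a \<Rightarrow> 'a \<Rightarrow> bool) \<Rightarrow> 'a \<Rightarrow> 'a set" where
  "pred_set T lt x = {y \<in> T. lt y x}"

definition pred_rel :: "'a set \<Rightarrow> ('a \<Rightarrow> 'a \<Rightarrow> bool) \<Rightarrow> 'a \<Rightarrow> 'a rel" where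
  "pred_rel T lt x = {(u, v). u \<in> pred_set T lt x \<and> v \<in> pred_set T lt x \<and> (lt u v \<or> u = v)}"

definition is_tree :: "'a set \<Rightarrow> ('a \<Rightarrow> 'a \<Rightarrow> bool) \<Rightarrow> bool" where
  "is_tree T lt \<longleftrightarrow>
     (\<forall>x\<in>T. \<not> lt x x) \<and>
     (\<forall>x\<in>T. \<forall>y\<in>T. \<forall>z\<in>T. lt x y \<longrightarrow> lt y z \<longrightarrow> lt x z) \<and>
     (\<forall>x\<in>T. Well_order (pred_rel T lt x))"

text \<open>Height omega_1: every node has countable height (countable set of predecessors),
  and every countable ordinal (represented as a well-order on a subset of nat) is
  the height of some node, i.e. every level below omega_1 is nonempty
  (equivalently, by downward closure of nonempty levels, some node has height at least it).\<close>
definition height_omega1 :: "'a set \<Rightarrow> ('a \<Rightarrow> 'a \<Rightarrow> bool) \<Rightarrow> bool" where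
  "height_omega1 T lt \<longleftrightarrow>
     (\<forall>x\<in>T. countable (pred_set T lt x)) \<and>
     (\<forall>W :: nat rel. Well_order W \<longrightarrow> (\<exists>x\<in>T. (W, pred_rel T lt x) \<in> ordLeq))"

definition is_chain :: "'a set \<Rightarrow> ('a \<Rightarrow> 'a \<Rightarrow> bool) \<Rightarrow> 'a set \<Rightarrow> bool" where
  "is_chain T lt B \<longleftrightarrow> B \<subseteq> T \<and> (\<forall>x\<in>B. \<forall>y\<in>B. x = y \<or> lt x y \<or> lt y x)"

definition is_branch :: "'a set \<Rightarrow> ('a \<Rightarrow> 'a \<Rightarrow> bool) \<Rightarrow> 'a set \<Rightarrow> bool" where
  "is_branch T lt B \<longleftrightarrow> is_chain T lt B \<and> (\<forall>C. is_chain T lt C \<longrightarrow> B \<subseteq> C \<longrightarrow> C = B)"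

definition wide_aronszajn :: "'a set \<Rightarrow> ('a \<Rightarrow> 'a \<Rightarrow> bool) \<Rightarrow> bool" where
  "wide_aronszajn T lt \<longleftrightarrow>
     is_tree T lt \<and> height_omega1 T lt \<and>
     (card_of T, cardSuc natLeq) \<in> ordIso \<and>
     (\<forall>B. is_branch T lt B \<longrightarrow> countable B)"

definition weak_embedding ::
  "'a set \<Rightarrow> ('a \<Rightarrow> 'a \<Rightarrow> bool) \<Rightarrow> 'b set \<Rightarrow> ('b \<Rightarrow> 'b \<Rightarrow> bool) \<Rightarrow> ('a \<Rightarrow> 'b) \<Rightarrow> bool" where
  "weak_embedding T1 lt1 T2 lt2 f \<longleftrightarrow>
     (\<forall>x\<in>T1. f x \<in> T2) \<and> (\<forall>x\<in>T1. \<forall>y\<in>T1. lt1 x y \<longrightarrow> lt2 (f x) (f y))"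

definition compatible :: "'p set \<Rightarrow> ('p \<Rightarrow> 'p \<Rightarrow> bool) \<Rightarrow> 'p \<Rightarrow> 'p \<Rightarrow> bool" where
  "compatible P le p q \<longleftrightarrow> (\<exists>r\<in>P. le r p \<and> le r q)"

definition is_poset :: "'p set \<Rightarrow> ('p \<Rightarrow> 'p \<Rightarrow> bool) \<Rightarrow> bool" where
  "is_poset P le \<longleftrightarrow>
     (\<forall>p\<in>P. le p p) \<and>
     (\<forall>p\<in>P. \<forall>q\<in>P. le p q \<longrightarrow> le q p \<longrightarrow> p = q) \<and>
     (\<forall>p\<in>P. \<forall>q\<in>P. \<forall>r\<in>P. le p q \<longrightarrow> le q r \<longrightarrow> le p r)"

definition ccc :: "'p set \<Rightarrow> ('p \<Rightarrow> 'p \<Rightarrow> bool) \<Rightarrow> bool" where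
  "ccc P le \<longleftrightarrow>
     (\<forall>A. A \<subseteq> P \<longrightarrow> (\<forall>p\<in>A. \<forall>q\<in>A. p \<noteq> q \<longrightarrow> \<not> compatible P le p q) \<longrightarrow> countable A)"

definition dense_in :: "'p set \<Rightarrow> ('p \<Rightarrow> 'p \<Rightarrow> bool) \<Rightarrow> 'p set \<Rightarrow> bool" where
  "dense_in P le D \<longleftrightarrow> D \<subseteq> P \<and> (\<forall>p\<in>P. \<exists>q\<in>D. le q p)"

definition is_filter :: "'p set \<Rightarrow> ('p \<Rightarrow> 'p \<Rightarrow> bool) \<Rightarrow> 'p set \<Rightarrow> bool" where
  "is_filter P le G \<longleftrightarrow>
     G \<subseteq> P \<and> G \<noteq> {} \<and>
     (\<forall>p\<in>G. \<forall>q\<in>P. le p q \<longrightarrow> q \<in> G) \<and>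
     (\<forall>p\<in>G. \<forall>q\<in>G. \<exists>r\<in>G. le r p \<and> le r q)"

definition MA_omega1 :: "'p itself \<Rightarrow> bool" where
  "MA_omega1 _ \<longleftrightarrow>
     (\<forall>(P :: 'p set) le. is_poset P le \<longrightarrow> P \<noteq> {} \<longrightarrow> ccc P le \<longrightarrow>
        (\<forall>\<D>. (\<forall>D\<in>\<D>. dense_in P le D) \<longrightarrow> (card_of \<D>, cardSuc natLeq) \<in> ordLeq \<longrightarrow>
           (\<exists>G. is_filter P le G \<and> (\<forall>D\<in>\<D>. G \<inter> D \<noteq> {}))))"

end

theory Submission
  imports Defs "HOL-Library.Disjoint_Sets"
begin

text \<open>
  Let \<open>U\<close> be a wide Aronszajn tree, and write \<open>x|\<xi>\<close> for the predecessor of \<open>x\<close> of height \<open>\<xi>\<close>.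
  Forcing with finite partial labellings of \<open>U\<close> by natural numbers gives, under \<open>MA(\<omega>\<^sub>1)\<close>,
  a map \<open>F : U \<rightarrow> \<nat>\<close> such that the label sequences \<open>\<xi> \<mapsto> F(x|\<xi>)\<close> are finite-to-one and any two of
  them differ at only finitely many places.  The forcing is ccc for the same reason as the forcing that
  specialises a tree without uncountable branches.

  The tree \<open>T\<close> of the sequences \<open>(F(x|\<xi>))\<^bsub>\<xi><\<alpha>\<^esub>\<close> does not embed into \<open>U\<close>.  Given \<open>f : T \<rightarrow> U\<close>, choose
  \<open>t\<^sub>\<alpha> \<in> T\<close> of height at least \<open>\<alpha>\<close>.  By coherence and pressing down, for uncountably many \<open>\<alpha>\<close> the
  labels of \<open>t\<^sub>\<alpha>\<close> and of \<open>f(t\<^sub>\<alpha>)\<close> agree on \<open>(\<gamma>, \<alpha>)\<close>, while those of the \<open>t\<^sub>\<alpha>\<close> coincide up to \<open>\<gamma>\<close>.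
  If \<open>\<delta>\<close> is the first place where \<open>t\<^sub>\<alpha>\<close> and \<open>t\<^sub>\<beta>\<close> differ, then \<open>f(t\<^sub>\<alpha>)\<close> and \<open>f(t\<^sub>\<beta>)\<close> both extend
  \<open>f(t\<^sub>\<alpha>|\<delta>)\<close>, whose height is at least \<open>\<delta>\<close>; so they have the same predecessor of height \<open>\<delta>\<close>, hence
  the same label there, and so do \<open>t\<^sub>\<alpha>\<close> and \<open>t\<^sub>\<beta>\<close>: a contradiction.
\<close>

unbundle cardinal_syntax

section \<open>Uncountable sets\<close>

lemma uncountable_fiber:
  assumes "uncountable A" "countable (f ` A)"
  obtains y where "y \<in> f ` A" "uncountable {x \<in> A. f x = y}"
proof -
  have "A = (\<Union>y\<in>f ` A. {x \<in> A. f x = y})" by auto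
  then have "\<not> (\<forall>y\<in>f ` A. countable {x \<in> A. f x = y})"
    using assms countable_UN[of "f ` A" "\<lambda>y. {x \<in> A. f x = y}"] by auto
  then show thesis using that by blast
qed

text \<open>Induction on the common size. If some point lies in uncountably many of the sets, it is
  removed and later put back into the root; otherwise a maximal pairwise disjoint subfamily is
  already uncountable, with empty root.\<close>

lemma delta_system_card:
  fixes s :: "'i \<Rightarrow> 'b set"
  assumes "uncountable A" "\<And>i. i \<in> A \<Longrightarrow> finite (s i) \<and> card (s i) = n"
  shows "\<exists>B R. B \<subseteq> A \<and> uncountable B \<and> (\<forall>i\<in>B. \<forall>j\<in>B. i \<noteq> j \<longrightarrow> s i \<inter> s j = R)"
  using assms
proof (induction n arbitrary: s A rule: less_induct)
  case (less n)
  show ?case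
  proof (cases "\<exists>y. uncountable {i \<in> A. y \<in> s i}")
    case True
    then obtain y where y: "uncountable {i \<in> A. y \<in> s i}" by blast
    then have "{i \<in> A. y \<in> s i} \<noteq> {}" by (intro notI) simp
    then obtain i where "i \<in> A" "y \<in> s i" by blast
    with less.prems(2)[of i] have pred: "n - 1 < n" by (cases n) auto
    have fin: "finite (s i - {y}) \<and> card (s i - {y}) = n - 1"
      if "i \<in> {i \<in> A. y \<in> s i}" for i
    proof -
      have "i \<in> A" "y \<in> s i" using that by blast+
      with less.prems(2)[OF this(1)] show ?thesis by (metis card_Diff_singleton finite_Diff)
    qed
    have "\<exists>B R. B \<subseteq> {i \<in> A. y \<in> s i} \<and> uncountable B \<and>
        (\<forall>i\<in>B. \<forall>j\<in>B. i \<noteq> j \<longrightarrow> (s i - {y}) \<inter> (s j - {y}) = R)"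
      by (rule less.IH[OF pred y]) (rule fin)
    then obtain B R where B: "B \<subseteq> {i \<in> A. y \<in> s i}" "uncountable B"
      and R: "\<forall>i\<in>B. \<forall>j\<in>B. i \<noteq> j \<longrightarrow> (s i - {y}) \<inter> (s j - {y}) = R"
      by (elim exE conjE) (rule that)
    have *: "s i \<inter> s j = insert y R" if "i \<in> B" "j \<in> B" "i \<noteq> j" for i j
    proof -
      have "(s i - {y}) \<inter> (s j - {y}) = R" using R that by blast
      moreover have "y \<in> s i" "y \<in> s j" using that B by auto
      ultimately show ?thesis by blast
    qed
    have "B \<subseteq> A" using B(1) by blast
    then show ?thesis using B(2) * by (intro exI[of _ B] exI[of _ "insert y R"]) simp
  next
    case False
    let ?D = "{B. B \<subseteq> A \<and> disjoint_family_on s B}"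
    have "\<exists>B\<in>?D. \<forall>X\<in>?D. B \<subseteq> X \<longrightarrow> X = B"
    proof (rule subset_Zorn')
      fix C assume C: "subset.chain ?D C"
      have disj: "s i \<inter> s j = {}" if ij: "i \<in> \<Union>C" "j \<in> \<Union>C" "i \<noteq> j" for i j
      proof -
        from ij obtain X Y where "X \<in> C" "Y \<in> C" "i \<in> X" "j \<in> Y" by blast
        moreover from this have "X \<subseteq> Y \<or> Y \<subseteq> X" using C by (meson subset_chain_def)
        ultimately obtain Z where "Z \<in> C" "i \<in> Z" "j \<in> Z" by blast
        moreover from \<open>Z \<in> C\<close> have "disjoint_family_on s Z" using C unfolding subset_chain_def by blast
        ultimately show ?thesis using ij(3) by (simp add: disjoint_family_on_def)
      qed
      have "\<Union>C \<subseteq> A" using C unfolding subset_chain_def by blast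
      with disj show "\<Union>C \<in> ?D" by (simp add: disjoint_family_on_def)
    qed
    then obtain B where BD: "B \<in> ?D" and maxD: "\<forall>X\<in>?D. B \<subseteq> X \<longrightarrow> X = B" by (elim bexE)
    have B: "B \<subseteq> A" "disjoint_family_on s B" using BD by simp_all
    have max: "X = B" if "X \<subseteq> A" "disjoint_family_on s X" "B \<subseteq> X" for X
      using maxD that by simp
    have "uncountable B"
    proof
      assume cB: "countable B"
      \<comment> \<open>By maximality every index outside \<open>B\<close> has a set that meets some
        \<open>s j\<close> with \<open>j\<close> in \<open>B\<close>, and each point of that
        countable union lies in only countably many sets.\<close>
      have "A \<subseteq> B \<union> (\<Union>y\<in>(\<Union>i\<in>B. s i). {i \<in> A. y \<in> s i})"
      proof
        fix i assume i: "i \<in> A"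
        show "i \<in> B \<union> (\<Union>y\<in>(\<Union>i\<in>B. s i). {i \<in> A. y \<in> s i})"
        proof (rule ccontr)
          assume n: "\<not> ?thesis"
          then have "\<forall>j\<in>B. s i \<inter> s j = {}" using i by blast
          then have "disjoint_family_on s (insert i B)"
            using B(2) unfolding disjoint_family_on_def by blast
          with i B(1) have "insert i B = B" by (intro max) auto
          with n show False by blast
        qed
      qed
      moreover have "countable (s i)" if "i \<in> B" for i
        using that B(1) less.prems(2)[of i] by (intro countable_finite) blast
      then have cU: "countable (\<Union>i\<in>B. s i)" using cB by (rule countable_UN[rotated])
      have "countable (B \<union> (\<Union>y\<in>(\<Union>i\<in>B. s i). {i \<in> A. y \<in> s i}))"
        using False by (intro countable_Un cB countable_UN[OF cU]) simp
      ultimately have "countable A" by (rule countable_subset)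
      with less.prems(1) show False by contradiction
    qed
    with B show ?thesis
      unfolding disjoint_family_on_def by (intro exI[of _ B] exI[of _ "{}"]) simp
  qed
qed

lemma delta_system:
  fixes s :: "'i \<Rightarrow> 'b set"
  assumes "uncountable A" "\<And>i. i \<in> A \<Longrightarrow> finite (s i)"
  obtains B R where "B \<subseteq> A" "uncountable B" "\<And>i j. i \<in> B \<Longrightarrow> j \<in> B \<Longrightarrow> i \<noteq> j \<Longrightarrow> s i \<inter> s j = R"
proof -
  obtain n where n: "uncountable {i \<in> A. card (s i) = n}"
    by (rule uncountable_fiber[OF assms(1), of "\<lambda>i. card (s i)"]) auto
  have "\<exists>B R. B \<subseteq> {i \<in> A. card (s i) = n} \<and> uncountable B \<and>
      (\<forall>i\<in>B. \<forall>j\<in>B. i \<noteq> j \<longrightarrow> s i \<inter> s j = R)"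
    by (rule delta_system_card[OF n]) (use assms(2) in simp)
  then obtain B R where "B \<subseteq> {i \<in> A. card (s i) = n}" "uncountable B"
      "\<forall>i\<in>B. \<forall>j\<in>B. i \<noteq> j \<longrightarrow> s i \<inter> s j = R" by (elim exE conjE) (rule that)
  then show thesis by (intro that[of B R]) auto
qed

section \<open>Uniform ultrafilters on uncountable sets\<close>

lemma ultrafilter_below:
  fixes F :: "'i filter"
  assumes "F \<noteq> bot"
  obtains G where "G \<le> F" "G \<noteq> bot" "\<And>P. eventually P G \<or> eventually (\<lambda>x. \<not> P x) G"
proof -
  let ?A = "{H. H \<le> F \<and> H \<noteq> bot}"
  have "\<exists>m\<in>?A. \<forall>a\<in>?A. a \<le> m \<longrightarrow> a = m"
  proof (rule predicate_Zorn)
    show "partial_order_on ?A (relation_of (\<lambda>x y. y \<le> x) ?A)"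
      by (auto simp: partial_order_on_def preorder_on_def refl_on_def trans_def antisym_def relation_of_def)
    fix C assume C: "C \<in> Chains (relation_of (\<lambda>x y. y \<le> x) ?A)"
    show "\<exists>u\<in>?A. \<forall>a\<in>C. u \<le> a"
    proof (cases "C = {}")
      case True then show ?thesis using assms by auto
    next
      case False
      have CA: "C \<subseteq> ?A" using C unfolding Chains_def relation_of_def by blast
      \<comment> \<open>What is eventual for the infimum of a chain is already eventual for a
        member; hence the infimum of proper filters is proper.\<close>
      have "eventually P (Inf C) \<longleftrightarrow> (\<exists>b\<in>C. eventually P b)" for P
      proof (rule eventually_Inf_base[OF False])
        fix G H assume "G \<in> C" "H \<in> C"
        then have "G \<le> H \<or> H \<le> G" using C unfolding Chains_def relation_of_def by blast
        then show "\<exists>x\<in>C. x \<le> inf G H" using \<open>G \<in> C\<close> \<open>H \<in> C\<close> by auto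
      qed
      then have "Inf C \<noteq> bot" using CA by (simp add: trivial_limit_def) blast
      moreover obtain H where "H \<in> C" using False by blast
      then have "Inf C \<le> F" using CA by (intro Inf_lower2[of H]) auto
      ultimately show ?thesis by (auto intro: Inf_lower)
    qed
  qed
  then obtain G where G: "G \<le> F" "G \<noteq> bot" and max: "\<And>H. H \<le> F \<Longrightarrow> H \<noteq> bot \<Longrightarrow> H \<le> G \<Longrightarrow> H = G"
    by auto
  have "eventually P G \<or> eventually (\<lambda>x. \<not> P x) G" for P
  proof (rule disjCI)
    assume *: "\<not> eventually (\<lambda>x. \<not> P x) G"
    let ?H = "inf G (principal {x. P x})"
    have "?H \<noteq> bot" using * by (simp add: trivial_limit_def eventually_inf_principal)
    then have "?H = G" using max G by (simp add: le_infI1)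
    moreover have "eventually P ?H" by (simp add: eventually_inf_principal)
    ultimately show "eventually P G" by simp
  qed
  with G that show thesis by blast
qed

text \<open>The co-countable subsets of \<open>A\<close> generate a proper filter. An ultrafilter
  refining it concentrates on \<open>A\<close> and ignores countably many exceptions.\<close>

lemma uniform_ultrafilter:
  assumes "uncountable A"
  obtains G where "G \<noteq> bot" "\<forall>P. countable {x \<in> A. \<not> P x} \<longrightarrow> eventually P G"
    "\<forall>P. eventually P G \<or> eventually (\<lambda>x. \<not> P x) G"
proof -
  define F where "F = Abs_filter (\<lambda>P. countable {x \<in> A. \<not> P x})"
  have ev: "eventually P F \<longleftrightarrow> countable {x \<in> A. \<not> P x}" for P
    unfolding F_def
  proof (rule eventually_Abs_filter, rule Filter.is_filter.intro)
    fix P Q assume "countable {x \<in> A. \<not> P x}" "countable {x \<in> A. \<not> Q x}"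
    then have "countable ({x \<in> A. \<not> P x} \<union> {x \<in> A. \<not> Q x})" by simp
    then show "countable {x \<in> A. \<not> (P x \<and> Q x)}" by (rule countable_subset[rotated]) auto
  next
    fix P Q assume "\<forall>x. P x \<longrightarrow> Q x" "countable {x \<in> A. \<not> P x}"
    then show "countable {x \<in> A. \<not> Q x}" by (auto elim: countable_subset[rotated])
  qed simp
  have "F \<noteq> bot" using assms by (simp add: trivial_limit_def ev)
  then show thesis
  proof (rule ultrafilter_below)
    fix G assume G: "G \<le> F" "G \<noteq> bot" "\<And>P. eventually P G \<or> eventually (\<lambda>x. \<not> P x) G"
    have "eventually P G" if "countable {x \<in> A. \<not> P x}" for P
      using G(1) that by (simp add: filter_leD ev)
    with G(2,3) show thesis by (intro that[of G]) simp_all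
  qed
qed

lemma ultrafilter_finite_split:
  assumes "\<And>P. eventually P G \<or> eventually (\<lambda>x. \<not> P x) G" "finite I"
    "eventually (\<lambda>x. \<exists>i\<in>I. Q i x) G" "G \<noteq> bot"
  shows "\<exists>i\<in>I. eventually (Q i) G"
proof (rule ccontr)
  assume "\<not> ?thesis"
  then have "\<forall>i\<in>I. eventually (\<lambda>x. \<not> Q i x) G" using assms(1) by blast
  then have "eventually (\<lambda>x. \<forall>i\<in>I. \<not> Q i x) G"
    using assms(2) by (simp add: eventually_ball_finite)
  with assms(3) have "eventually (\<lambda>x. False) G" by eventually_elim blast
  with assms(4) show False by (simp add: trivial_limit_def)
qed

lemma finite_subsets_le:
  assumes "infinite A"
  shows "|Fpow A| \<le>o |A|"
proof -
  let ?F = "\<lambda>n. {X. X \<subseteq> A \<and> finite X \<and> card X = n}"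
  have "|?F n| \<le>o |A|" for n
  proof (induction n)
    case 0
    have "?F 0 = {{}}" by auto
    then show ?case using assms by (auto intro: card_of_singl_ordLeq)
  next
    case (Suc n)
    have "?F (Suc n) \<subseteq> (\<lambda>(x, X). insert x X) ` (A \<times> ?F n)"
    proof
      fix X assume X: "X \<in> ?F (Suc n)"
      then obtain x where "x \<in> X" by fastforce
      then have "X = (\<lambda>(x, X). insert x X) (x, X - {x})" "(x, X - {x}) \<in> A \<times> ?F n" using X by auto
      then show "X \<in> (\<lambda>(x, X). insert x X) ` (A \<times> ?F n)" by (rule image_eqI)
    qed
    then have "|?F (Suc n)| \<le>o |(\<lambda>(x, X). insert x X) ` (A \<times> ?F n)|" by (rule card_of_mono1)
    also have "|(\<lambda>(x, X). insert x X) ` (A \<times> ?F n)| \<le>o |A \<times> ?F n|" by (rule card_of_image)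
    also have "|A \<times> ?F n| \<le>o |A|"
      using Suc assms by (intro card_of_Times_ordLeq_infinite_Field card_of_Card_order card_of_mono1)
        (simp_all only: Field_card_of, simp)
    finally show ?case .
  qed
  moreover have "Fpow A = (\<Union>n\<in>(UNIV::nat set). ?F n)" by (auto simp: Fpow_def)
  moreover have "|UNIV :: nat set| \<le>o |A|" using assms infinite_iff_card_of_nat by blast
  ultimately show ?thesis using card_of_UNION_ordLeq_infinite[OF assms, of UNIV ?F] by simp
qed

section \<open>The first uncountable ordinal\<close>

definition nat_set_wo :: "nat set rel" where
  "nat_set_wo = (SOME r. well_order_on UNIV r)"

lemma nat_set_wo: "well_order_on UNIV nat_set_wo"
  unfolding nat_set_wo_def by (rule someI_ex) (rule well_order_on)

lemma nat_set_wo_rels: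
  shows "refl nat_set_wo" "trans nat_set_wo" "antisym nat_set_wo" "total nat_set_wo"
    "wf (nat_set_wo - Id)"
  using nat_set_wo by (auto simp: order_on_defs)

lemma uncountable_nat_sets: "uncountable (UNIV :: nat set set)"
proof
  assume "countable (UNIV :: nat set set)"
  then have "range (from_nat_into (UNIV :: nat set set)) = Pow UNIV"
    by (simp add: range_from_nat_into)
  with Cantors_theorem[of "UNIV :: nat set"] show False by blast
qed

text \<open>The elements with countably many predecessors form an initial segment of type \<open>\<omega>\<^sub>1\<close>.\<close>

definition omega1_set :: "nat set set" where
  "omega1_set = {x. countable {y. (y, x) \<in> nat_set_wo}}"

text \<open>If \<open>omega1_set\<close> were countable, the least element outside it would itself
  have only countably many predecessors.\<close>

lemma uncountable_omega1_set: "uncountable omega1_set"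
proof
  assume c: "countable omega1_set"
  have "\<exists>x. x \<notin> omega1_set" using c uncountable_nat_sets
    by (metis UNIV_eq_I)
  then obtain x where x: "x \<notin> omega1_set" and min: "\<And>y. (y, x) \<in> nat_set_wo - Id \<Longrightarrow> y \<in> omega1_set"
    using wfE_min[OF nat_set_wo_rels(5), of _ "- omega1_set"] by (metis ComplD ComplI)
  have "{y. (y, x) \<in> nat_set_wo} \<subseteq> insert x omega1_set" using min by auto
  then have "countable {y. (y, x) \<in> nat_set_wo}" by (rule countable_subset) (simp add: c)
  with x show False by (simp add: omega1_set_def)
qed

typedef omega1 = omega1_set
  using uncountable_omega1_set by (metis countable_empty ex_in_conv)

instantiation omega1 :: wellorder
begin

definition less_eq_omega1 :: "omega1 \<Rightarrow> omega1 \<Rightarrow> bool" where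
  "less_eq_omega1 x y \<longleftrightarrow> (Rep_omega1 x, Rep_omega1 y) \<in> nat_set_wo"

definition less_omega1 :: "omega1 \<Rightarrow> omega1 \<Rightarrow> bool" where
  "less_omega1 x y \<longleftrightarrow> x \<le> y \<and> x \<noteq> y"

instance
proof
  have rf: "x \<le> x" for x :: omega1
    unfolding less_eq_omega1_def using nat_set_wo_rels(1) by (simp add: refl_onD)
  have as: "x = y" if "x \<le> y" "y \<le> x" for x y :: omega1
    using antisymD[OF nat_set_wo_rels(3), of "Rep_omega1 x" "Rep_omega1 y"] that
    by (simp add: less_eq_omega1_def Rep_omega1_inject)
  fix x y z :: omega1
  show "x \<le> x" by (rule rf)
  show "x = y" if "x \<le> y" "y \<le> x" using that by (rule as)
  show "(x < y) = (x \<le> y \<and> \<not> y \<le> x)"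
    unfolding less_omega1_def using as[of x y] rf[of x] by auto
  show "x \<le> z" if "x \<le> y" "y \<le> z"
    using that transD[OF nat_set_wo_rels(2)] unfolding less_eq_omega1_def by blast
  show "x \<le> y \<or> y \<le> x"
  proof (cases "x = y")
    case False
    then show ?thesis
      using nat_set_wo_rels(4) by (simp add: less_eq_omega1_def total_on_def Rep_omega1_inject)
  qed (simp add: rf)
next
  fix P :: "omega1 \<Rightarrow> bool" and a
  assume step: "\<And>x. (\<And>y. y < x \<Longrightarrow> P y) \<Longrightarrow> P x"
  have "wf (inv_image (nat_set_wo - Id) Rep_omega1)"
    using nat_set_wo_rels(5) by (rule wf_inv_image)
  then show "P a"
  proof (induction a rule: wf_induct_rule)
    case (less x)
    show ?case
    proof (rule step)
      fix y assume "y < x"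
      then have "(y, x) \<in> inv_image (nat_set_wo - Id) Rep_omega1"
        by (simp add: less_omega1_def less_eq_omega1_def Rep_omega1_inject)
      then show "P y" by (rule less)
    qed
  qed
qed

end

lemma uncountable_omega1: "uncountable (UNIV :: omega1 set)"
  using uncountable_omega1_set type_definition.Rep_range[OF type_definition_omega1]
  by (metis countable_image)

lemma countable_atMost_omega1: "countable {..a :: omega1}"
proof -
  have "Rep_omega1 ` {..a} \<subseteq> {y. (y, Rep_omega1 a) \<in> nat_set_wo}"
    by (auto simp: less_eq_omega1_def)
  moreover have "countable {y. (y, Rep_omega1 a) \<in> nat_set_wo}"
    using Rep_omega1[of a] by (simp add: omega1_set_def)
  ultimately have "countable (Rep_omega1 ` {..a})" using countable_subset by blast
  then show ?thesis by (rule countable_image_inj_on) (simp add: inj_on_def Rep_omega1_inject)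
qed

lemma countable_lessThan_omega1: "countable {..<a :: omega1}"
  by (rule countable_subset[OF _ countable_atMost_omega1[of a]]) auto

lemma countable_omega1_bounded:
  assumes "countable (A :: omega1 set)"
  shows "\<exists>b. \<forall>a\<in>A. a < b"
proof -
  have "countable (\<Union>a\<in>A. {..a})" using assms countable_atMost_omega1 by simp
  then have "(\<Union>a\<in>A. {..a}) \<noteq> UNIV" using uncountable_omega1 by auto
  then obtain b where "\<forall>a\<in>A. \<not> b \<le> a" by auto
  then show ?thesis by (auto simp: not_le)
qed

lemma uncountable_omega1_unbounded:
  assumes "uncountable (A :: omega1 set)"
  obtains a where "a \<in> A" "b < a"
proof -
  have "\<not> A \<subseteq> {..b}"
  proof
    assume "A \<subseteq> {..b}"
    then have "countable A" using countable_atMost_omega1 by (rule countable_subset)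
    with assms show False by contradiction
  qed
  then obtain a where "a \<in> A" "\<not> a \<le> b" by blast
  then show thesis by (intro that[of a]) (simp_all add: not_le)
qed

text \<open>A case of Fodor's lemma, for functions regressive on a whole tail, by closing off
  instead of club sets. If all fibres are countable, \<open>g c\<close> bounds the points sent to
  \<open>c\<close> or lower, and the limit of the iterates of \<open>g\<close> from \<open>b\<close>
  cannot be pressed down.\<close>

lemma pressing_down:
  fixes h :: "omega1 \<Rightarrow> omega1"
  assumes "\<And>a. a > b \<Longrightarrow> h a < a"
  obtains c where "uncountable {a. h a = c}"
proof (rule ccontr)
  assume nt: "\<not> thesis"
  have cnt: "countable {a. h a = c}" for c
    by (rule ccontr) (use nt that[of c] in contradiction)
  have "\<exists>d. \<forall>a. h a \<le> c \<longrightarrow> a < d" for c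
  proof -
    have "{a. h a \<le> c} = (\<Union>c'\<in>{..c}. {a. h a = c'})" by auto
    then have "countable {a. h a \<le> c}" using countable_atMost_omega1 cnt by simp
    then show ?thesis using countable_omega1_bounded[of "{a. h a \<le> c}"] by simp
  qed
  then have "\<forall>c. \<exists>d. \<forall>a. h a \<le> c \<longrightarrow> a < d" by blast
  from choice[OF this] obtain g where g: "\<And>c a. h a \<le> c \<Longrightarrow> a < g c" by blast
  define s where "s n = (g ^^ n) b" for n
  obtain u where ub: "\<forall>n. s n < u"
    using countable_omega1_bounded[of "range s"] by auto
  \<comment> \<open>\<open>l\<close> is the least strict upper bound of \<open>s\<close>, so a value
    \<open>h l\<close> below it is at most some \<open>s n\<close>; then \<open>l < g (s n)\<close>,
    which is \<open>s (Suc n)\<close>.\<close>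
  define l where "l = (LEAST u. \<forall>n. s n < u)"
  have l: "s n < l" for n unfolding l_def using LeastI[of "\<lambda>u. \<forall>n. s n < u", OF ub] by blast
  have "b < l" using l[of 0] by (simp add: s_def)
  then have "h l < l" by (rule assms)
  then have "\<not> (\<forall>n. s n < h l)" unfolding l_def by (rule not_less_Least)
  then obtain n where "h l \<le> s n" by (auto simp: not_less)
  then have "l < s (Suc n)" using g by (simp add: s_def)
  with l show False by (meson less_asym)
qed

section \<open>Trees with a height function\<close>

text \<open>Heights in the well-ordered type \<open>omega1\<close> stand in for well-ordered
  predecessor sets; with \<open>ht_onto\<close>, the height is the order type of the
  predecessors.\<close>

locale tree_ht =
  fixes U :: "'a set" and lt :: "'a \<Rightarrow> 'a \<Rightarrow> bool" (infix \<open>\<sqsubset>\<close> 50) and ht :: "'a \<Rightarrow> omega1"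
  assumes lt_trans: "\<lbrakk>x \<in> U; y \<in> U; z \<in> U; x \<sqsubset> y; y \<sqsubset> z\<rbrakk> \<Longrightarrow> x \<sqsubset> z"
    and lt_linear: "\<lbrakk>x \<in> U; y \<in> U; z \<in> U; x \<sqsubset> z; y \<sqsubset> z\<rbrakk> \<Longrightarrow> x = y \<or> x \<sqsubset> y \<or> y \<sqsubset> x"
    and ht_less: "\<lbrakk>x \<in> U; y \<in> U; x \<sqsubset> y\<rbrakk> \<Longrightarrow> ht x < ht y"
    and ht_onto: "\<lbrakk>x \<in> U; \<xi> < ht x\<rbrakk> \<Longrightarrow> \<exists>y\<in>U. y \<sqsubset> x \<and> ht y = \<xi>"
begin

text \<open>\<open>anc x \<xi>\<close> is the node \<open>x|\<xi>\<close> for \<open>\<xi> \<le> ht x\<close>, and unspecified for larger \<open>\<xi>\<close>.\<close>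

definition anc :: "'a \<Rightarrow> omega1 \<Rightarrow> 'a" where
  "anc x \<xi> = (THE y. y \<in> U \<and> (y = x \<or> y \<sqsubset> x) \<and> ht y = \<xi>)"

lemma anc_unique:
  assumes "x \<in> U" "y \<in> U" "y = x \<or> y \<sqsubset> x" "z \<in> U" "z = x \<or> z \<sqsubset> x" "ht y = ht z"
  shows "y = z"
  using assms lt_linear[of y z x] ht_less[of y x] ht_less[of z x] ht_less[of y z] ht_less[of z y]
  by auto

lemma anc_eqI:
  assumes "x \<in> U" "y \<in> U" "y = x \<or> y \<sqsubset> x"
  shows "anc x (ht y) = y"
  unfolding anc_def
proof (rule the_equality)
  fix z assume "z \<in> U \<and> (z = x \<or> z \<sqsubset> x) \<and> ht z = ht y"
  with assms show "z = y" by (intro anc_unique[of x z y]) auto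
qed (use assms in simp)

lemma anc:
  assumes "x \<in> U" "\<xi> \<le> ht x"
  shows anc_in: "anc x \<xi> \<in> U" and ht_anc: "ht (anc x \<xi>) = \<xi>"
    and anc_below: "anc x \<xi> = x \<or> anc x \<xi> \<sqsubset> x"
proof -
  have "\<exists>y\<in>U. (y = x \<or> y \<sqsubset> x) \<and> ht y = \<xi>"
  proof (cases "\<xi> = ht x")
    case False
    with assms have "\<xi> < ht x" by simp
    from ht_onto[OF assms(1) this] show ?thesis by auto
  qed (use assms in auto)
  then obtain y where y: "y \<in> U" "y = x \<or> y \<sqsubset> x" "ht y = \<xi>" by blast
  from anc_eqI[OF assms(1) this(1,2)] y(3) have "anc x \<xi> = y" by simp
  with y show "anc x \<xi> \<in> U" "ht (anc x \<xi>) = \<xi>" "anc x \<xi> = x \<or> anc x \<xi> \<sqsubset> x" by simp_all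
qed

lemma anc_self: "x \<in> U \<Longrightarrow> anc x (ht x) = x"
  by (rule anc_eqI) simp_all

lemma anc_anc:
  assumes "x \<in> U" "\<xi> \<le> \<eta>" "\<eta> \<le> ht x"
  shows "anc (anc x \<eta>) \<xi> = anc x \<xi>"
proof -
  let ?y = "anc x \<eta>"
  let ?z = "anc ?y \<xi>"
  have y: "?y \<in> U" "ht ?y = \<eta>" "?y = x \<or> ?y \<sqsubset> x"
    using anc[OF assms(1,3)] by simp_all
  then have z: "?z \<in> U" "ht ?z = \<xi>" "?z = ?y \<or> ?z \<sqsubset> ?y"
    using anc[of ?y \<xi>] assms(2) by simp_all
  then have "?z = x \<or> ?z \<sqsubset> x" using y lt_trans[of ?z ?y x] assms(1) by auto
  from anc_eqI[OF assms(1) z(1) this] z(2) show ?thesis by simp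
qed

lemma countable_below:
  assumes "x \<in> U"
  shows "countable {y \<in> U. y \<sqsubset> x}"
proof (rule countable_image_inj_on)
  show "countable (ht ` {y \<in> U. y \<sqsubset> x})"
    by (rule countable_subset[OF _ countable_lessThan_omega1[of "ht x"]])
      (use assms ht_less in auto)
  show "inj_on ht {y \<in> U. y \<sqsubset> x}"
    using assms by (auto intro!: inj_onI anc_unique[of x])
qed

section \<open>Finite sets with no comparable nodes between them\<close>

definition no_uncountable_chain :: bool where
  "no_uncountable_chain \<longleftrightarrow>
     (\<forall>C\<subseteq>U. (\<forall>x\<in>C. \<forall>y\<in>C. x = y \<or> x \<sqsubset> y \<or> y \<sqsubset> x) \<longrightarrow> countable C)"

text \<open>The combinatorial core of the chain condition. Were it false, an ultrafilter would pick
  for each \<open>i\<close> one pair \<open>(k, l)\<close> such that node \<open>k\<close> of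
  \<open>W i\<close> is below node \<open>l\<close> of \<open>W j\<close> for almost all
  \<open>j\<close>. Uncountably many \<open>i\<close> share a pair, and their nodes form an
  uncountable chain.\<close>

lemma incomparable_pair:
  assumes nc: no_uncountable_chain
    and A: "uncountable A" and W: "\<And>i. i \<in> A \<Longrightarrow> finite (W i) \<and> W i \<subseteq> U"
    and disj: "\<And>i j. i \<in> A \<Longrightarrow> j \<in> A \<Longrightarrow> i \<noteq> j \<Longrightarrow> W i \<inter> W j = {}"
  shows "\<exists>i\<in>A. \<exists>j\<in>A. i \<noteq> j \<and> (\<forall>x\<in>W i. \<forall>y\<in>W j. \<not> x \<sqsubset> y \<and> \<not> y \<sqsubset> x)"
proof (rule ccontr)
  assume "\<not> ?thesis"
  then have comp: "\<exists>x\<in>W i. \<exists>y\<in>W j. x \<sqsubset> y \<or> y \<sqsubset> x" if "i \<in> A" "j \<in> A" "i \<noteq> j" for i j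
    using that by blast
  obtain n where n: "uncountable {i \<in> A. card (W i) = n}"
    by (rule uncountable_fiber[OF A, of "\<lambda>i. card (W i)"]) auto
  define A' where "A' = {i \<in> A. card (W i) = n}"
  have "\<forall>i\<in>A'. \<exists>e :: nat \<Rightarrow> 'a. W i = e ` {..<n}"
  proof
    fix i assume "i \<in> A'"
    then have "finite (W i)" "card (W i) = n" using W by (auto simp: A'_def)
    then obtain e where "bij_betw e {0..<n} (W i)" using ex_bij_betw_nat_finite by blast
    then show "\<exists>e :: nat \<Rightarrow> 'a. W i = e ` {..<n}"
      by (intro exI[of _ e]) (simp add: bij_betw_def lessThan_atLeast0)
  qed
  from bchoice[OF this] obtain e :: "_ \<Rightarrow> nat \<Rightarrow> 'a" where e: "\<And>i. i \<in> A' \<Longrightarrow> W i = e i ` {..<n}" by blast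
  have eU: "e i k \<in> U" if "i \<in> A'" "k < n" for i k
    using e[OF that(1)] W[of i] that by (auto simp: A'_def)
  obtain G where G: "G \<noteq> bot" "\<forall>P. countable {x \<in> A'. \<not> P x} \<longrightarrow> eventually P G"
    "\<forall>P. eventually P G \<or> eventually (\<lambda>x. \<not> P x) G"
    using uniform_ultrafilter[OF n[folded A'_def]] .
  have "\<exists>p\<in>{..<n} \<times> {..<n}. eventually (\<lambda>j. j \<in> A' \<and> e i (fst p) \<sqsubset> e j (snd p)) G"
    if i: "i \<in> A'" for i
  proof (rule ultrafilter_finite_split[OF G(3)[rule_format] _ G(2)[rule_format] G(1)])
    have sub: "countable {j \<in> A'. y \<in> W j}" for y
    proof (cases "\<exists>j\<in>A'. y \<in> W j")
      case True
      then obtain j where "j \<in> A'" "y \<in> W j" by blast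
      then have "{j \<in> A'. y \<in> W j} \<subseteq> {j}" using disj by (auto simp: A'_def)
      then show ?thesis by (rule countable_subset) simp
    next
      case False
      then have "{j \<in> A'. y \<in> W j} = {}" by blast
      then show ?thesis by (simp only: countable_empty)
    qed
    \<comment> \<open>Only countably many \<open>W j\<close> have a node below one of
      \<open>W i\<close>, since predecessor sets are countable and the \<open>W j\<close> are
      disjoint. For every other \<open>j\<close> distinct from \<open>i\<close> the comparability
      goes upwards from \<open>W i\<close>.\<close>
    have "{j \<in> A'. \<not> (\<exists>p\<in>{..<n} \<times> {..<n}. j \<in> A' \<and> e i (fst p) \<sqsubset> e j (snd p))}
        \<subseteq> insert i (\<Union>x\<in>W i. \<Union>y\<in>{y \<in> U. y \<sqsubset> x}. {j \<in> A'. y \<in> W j})" (is "?L \<subseteq> ?R")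
    proof
      fix j assume j: "j \<in> ?L"
      show "j \<in> ?R"
      proof (cases "j = i")
        case False
        have "j \<in> A'" using j by simp
        with False i obtain x y where xy: "x \<in> W i" "y \<in> W j" "x \<sqsubset> y \<or> y \<sqsubset> x"
          using comp[of i j] by (auto simp: A'_def)
        from xy(1,2) e[OF i] e[OF \<open>j \<in> A'\<close>] obtain k l
          where kl: "k < n" "l < n" "x = e i k" "y = e j l" by auto
        have "\<not> x \<sqsubset> y"
        proof
          assume "x \<sqsubset> y"
          then have "\<exists>p\<in>{..<n} \<times> {..<n}. j \<in> A' \<and> e i (fst p) \<sqsubset> e j (snd p)"
            using kl \<open>j \<in> A'\<close> by (intro bexI[of _ "(k, l)"]) auto
          with j show False by simp
        qed
        moreover have "y \<in> U" using xy(2) W[of j] \<open>j \<in> A'\<close> by (auto simp: A'_def)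
        ultimately show ?thesis using xy \<open>j \<in> A'\<close> by auto
      qed simp
    qed
    moreover have "countable ?R"
    proof (intro countable_insert countable_UN sub countable_below)
      have "i \<in> A" using i by (simp add: A'_def)
      then show "countable (W i)" "\<And>x. x \<in> W i \<Longrightarrow> x \<in> U"
        using W[of i] by (auto intro: countable_finite)
    qed
    ultimately show "countable {j \<in> A'. \<not> (\<exists>p\<in>{..<n} \<times> {..<n}. j \<in> A' \<and> e i (fst p) \<sqsubset> e j (snd p))}"
      by (rule countable_subset)
  qed simp
  then have "\<forall>i\<in>A'. \<exists>p. p \<in> {..<n} \<times> {..<n} \<and>
      eventually (\<lambda>j. j \<in> A' \<and> e i (fst p) \<sqsubset> e j (snd p)) G" by blast
  from bchoice[OF this] obtain p where p: "\<And>i. i \<in> A' \<Longrightarrow> p i \<in> {..<n} \<times> {..<n}"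
    "\<And>i. i \<in> A' \<Longrightarrow> eventually (\<lambda>j. j \<in> A' \<and> e i (fst (p i)) \<sqsubset> e j (snd (p i))) G" by blast
  have "uncountable A'" using n by (simp add: A'_def)
  then obtain c where c: "uncountable {i \<in> A'. p i = c}"
    by (rule uncountable_fiber[of _ p]) auto
  define B where "B = {i \<in> A'. p i = c}"
  obtain a b where ab: "c = (a, b)" by (cases c)
  have ub: "uncountable B" using c by (simp add: B_def)
  have BA: "i \<in> A'" "a < n" "b < n" "eventually (\<lambda>j. j \<in> A' \<and> e i a \<sqsubset> e j b) G" if "i \<in> B" for i
    using that p[of i] ab by (auto simp: B_def)
  have "countable ((\<lambda>i. e i a) ` B)"
  proof -
    have "(\<lambda>i. e i a) ` B \<subseteq> U" using eU BA by blast
    moreover have "e i a = e i' a \<or> e i a \<sqsubset> e i' a \<or> e i' a \<sqsubset> e i a" if i: "i \<in> B" "i' \<in> B" for i i'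
    proof -
      \<comment> \<open>Two sets of the ultrafilter meet, so both nodes lie below a common
        \<open>e j b\<close> and are therefore comparable.\<close>
      from BA(4)[OF i(1)] BA(4)[OF i(2)]
      have "eventually (\<lambda>j. j \<in> A' \<and> e i a \<sqsubset> e j b \<and> e i' a \<sqsubset> e j b) G"
        by eventually_elim simp
      then obtain j where j: "j \<in> A'" "e i a \<sqsubset> e j b" "e i' a \<sqsubset> e j b"
        using G(1) eventually_happens by blast
      with i show ?thesis using BA eU by (intro lt_linear[of _ _ "e j b"]) auto
    qed
    ultimately show ?thesis using nc unfolding no_uncountable_chain_def by simp
  qed
  moreover have "inj_on (\<lambda>i. e i a) B"
  proof (rule inj_onI, rule ccontr)
    fix i j assume ij: "i \<in> B" "j \<in> B" "e i a = e j a" "i \<noteq> j"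
    have "e i a \<in> W i" if "i \<in> B" for i
      using e[OF BA(1)[OF that]] BA(2)[OF that] by simp
    from this[OF ij(1)] this[OF ij(2)] have "e i a \<in> W i" "e j a \<in> W j" .
    moreover have "i \<in> A" "j \<in> A" using ij(1,2) by (simp_all add: B_def A'_def)
    ultimately show False using disj[of i j] ij(3,4) by auto
  qed
  ultimately have "countable B" by (rule countable_image_inj_on)
  with ub show False by contradiction
qed

section \<open>The forcing\<close>

text \<open>Partial functions as graphs. The last clause closes the domain under restriction to its
  own levels, which the transitivity of \<open>ext\<close> relies on.\<close>

definition conds :: "('a \<times> nat) set set" where
  "conds = {p. finite p \<and> Domain p \<subseteq> U \<and> single_valued p \<and>
     (\<forall>x\<in>Domain p. \<forall>y\<in>Domain p. ht y \<le> ht x \<longrightarrow> anc x (ht y) \<in> Domain p)}"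

text \<open>
  At a level not yet touched by \<open>p\<close>, a stronger condition gives all nodes below \<open>p\<close> the same label,
  and this label is not used by \<open>p\<close>.  The first makes the generic labelling coherent, the second makes
  it finite-to-one along chains.
\<close>

definition ext :: "('a \<times> nat) set \<Rightarrow> ('a \<times> nat) set \<Rightarrow> bool" where
  "ext q p \<longleftrightarrow> p \<subseteq> q \<and>
     (\<forall>x\<in>Domain p. \<forall>y\<in>Domain p. \<forall>\<xi> k.
        \<xi> \<le> ht x \<longrightarrow> \<xi> \<le> ht y \<longrightarrow> \<xi> \<notin> ht ` Domain p \<longrightarrow> (anc x \<xi>, k) \<in> q \<longrightarrow>
        k \<notin> Range p \<and> (anc y \<xi>, k) \<in> q)"

lemma condsD:
  assumes "p \<in> conds"
  shows "finite p" "Domain p \<subseteq> U" "single_valued p"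
    "\<lbrakk>x \<in> Domain p; y \<in> Domain p; ht y \<le> ht x\<rbrakk> \<Longrightarrow> anc x (ht y) \<in> Domain p"
  using assms by (simp_all add: conds_def)

lemma extD:
  assumes "ext q p"
  shows "p \<subseteq> q"
    "\<lbrakk>x \<in> Domain p; y \<in> Domain p; \<xi> \<le> ht x; \<xi> \<le> ht y; \<xi> \<notin> ht ` Domain p; (anc x \<xi>, k) \<in> q\<rbrakk>
      \<Longrightarrow> k \<notin> Range p \<and> (anc y \<xi>, k) \<in> q"
  using assms unfolding ext_def by blast+

text \<open>The second clause of \<open>ext\<close> is vacuous here: a labelled
  \<open>anc x \<xi>\<close> has height \<open>\<xi>\<close>, so that level is touched.\<close>

lemma ext_refl: "p \<in> conds \<Longrightarrow> ext p p"
  unfolding ext_def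
proof (intro conjI ballI allI impI subset_refl)
  fix x y \<xi> k
  assume p: "p \<in> conds" and x: "x \<in> Domain p" "\<xi> \<le> ht x" "\<xi> \<notin> ht ` Domain p" "(anc x \<xi>, k) \<in> p"
  have "x \<in> U" using condsD(2)[OF p] x(1) by blast
  then have "ht (anc x \<xi>) = \<xi>" using x(2) by (rule ht_anc)
  moreover have "anc x \<xi> \<in> Domain p" using x(4) by blast
  ultimately have "\<xi> \<in> ht ` Domain p" by force
  with x(3) show "k \<notin> Range p" "(anc y \<xi>, k) \<in> p" by simp_all
qed

text \<open>At a level touched by \<open>q\<close> the closure of its domain provides a label in
  \<open>q\<close>, and \<open>ext q p\<close> decides; at any other level \<open>ext r q\<close>
  decides.\<close>

lemma ext_trans:
  assumes p: "p \<in> conds" and q: "q \<in> conds" and r: "r \<in> conds" and rq: "ext r q" and qp: "ext q p"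
  shows "ext r p"
  unfolding ext_def
proof (intro conjI ballI allI impI)
  show "p \<subseteq> r" using extD(1)[OF rq] extD(1)[OF qp] by blast
  fix x y \<xi> k
  assume x: "x \<in> Domain p" "y \<in> Domain p" "\<xi> \<le> ht x" "\<xi> \<le> ht y" "\<xi> \<notin> ht ` Domain p" "(anc x \<xi>, k) \<in> r"
  have xq: "x \<in> Domain q" "y \<in> Domain q" using x(1,2) extD(1)[OF qp] by blast+
  have "k \<notin> Range p \<and> (anc y \<xi>, k) \<in> r"
  proof (cases "\<xi> \<in> ht ` Domain q")
    case True
    then obtain z where z: "z \<in> Domain q" "ht z = \<xi>" by blast
    then have "anc x \<xi> \<in> Domain q" using condsD(4)[OF q xq(1) z(1)] x(3) by simp
    then obtain k' where k': "(anc x \<xi>, k') \<in> q" by blast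
    then have "(anc x \<xi>, k') \<in> r" using extD(1)[OF rq] by blast
    then have "k' = k" using single_valuedD[OF condsD(3)[OF r] _ x(6)] by blast
    with k' have "(anc x \<xi>, k) \<in> q" by simp
    from extD(2)[OF qp x(1-5) this] show ?thesis using extD(1)[OF rq] by blast
  next
    case False
    from extD(2)[OF rq xq x(3,4) this x(6)] show ?thesis using extD(1)[OF qp] by blast
  qed
  then show "k \<notin> Range p" "(anc y \<xi>, k) \<in> r" by simp_all
qed

lemma poset_conds: "is_poset conds ext"
  unfolding is_poset_def
proof (intro conjI ballI impI)
  fix p q assume "ext p q" "ext q p"
  then show "p = q" using extD(1) by blast
qed (use ext_refl ext_trans in blast)+

text \<open>For \<open>Z\<close> inside \<open>U\<close>, one step closes \<open>Z\<close> under
  restriction to its own levels, since restrictions compose, and no new level appears.\<close>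

definition cl :: "'a set \<Rightarrow> 'a set" where
  "cl Z = (\<lambda>(z, w). anc z (ht w)) ` {(z, w) \<in> Z \<times> Z. ht w \<le> ht z}"

lemma cl:
  assumes "Z \<subseteq> U"
  shows cl_superset: "Z \<subseteq> cl Z" and cl_subset: "cl Z \<subseteq> U" and ht_cl: "ht ` cl Z = ht ` Z"
    and cl_anc: "\<lbrakk>x \<in> cl Z; \<xi> \<in> ht ` Z; \<xi> \<le> ht x\<rbrakk> \<Longrightarrow> anc x \<xi> \<in> cl Z"
proof -
  show sup: "Z \<subseteq> cl Z"
  proof
    fix z assume "z \<in> Z"
    then show "z \<in> cl Z" unfolding cl_def
      using assms anc_self[of z] by (intro image_eqI[of _ _ "(z, z)"]) auto
  qed
  show "cl Z \<subseteq> U" unfolding cl_def using assms anc_in by auto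
  have "ht (anc z (ht w)) = ht w" if "z \<in> Z" "ht w \<le> ht z" for z w
    using that assms ht_anc[of z "ht w"] by auto
  then have "ht ` cl Z \<subseteq> ht ` Z" unfolding cl_def by auto
  with sup show "ht ` cl Z = ht ` Z" by blast
  assume x: "x \<in> cl Z" "\<xi> \<in> ht ` Z" "\<xi> \<le> ht x"
  then obtain z w v where zw: "z \<in> Z" "w \<in> Z" "ht w \<le> ht z" "x = anc z (ht w)" "v \<in> Z" "\<xi> = ht v"
    unfolding cl_def by auto
  have "z \<in> U" using assms zw(1) by blast
  then have "ht x = ht w" using zw ht_anc by simp
  with x(3) zw \<open>z \<in> U\<close> have "anc x \<xi> = anc z (ht v)" "ht v \<le> ht z" using anc_anc by simp_all
  then show "anc x \<xi> \<in> cl Z" unfolding cl_def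
    using zw by (intro image_eqI[of _ _ "(z, v)"]) auto
qed

lemma finite_cl: "finite Z \<Longrightarrow> finite (cl Z)"
  unfolding cl_def by (rule finite_imageI) (rule finite_subset[of _ "Z \<times> Z"], auto)

text \<open>One label for all added nodes makes the labels on a new level agree; a fresh
  \<open>k\<close> also avoids the old labels. These are the two demands of
  \<open>ext\<close>.\<close>

definition fill :: "('a \<times> nat) set \<Rightarrow> 'a set \<Rightarrow> nat \<Rightarrow> ('a \<times> nat) set" where
  "fill p Z k = p \<union> (cl Z - Domain p) \<times> {k}"

lemma Domain_fill: "Z \<subseteq> U \<Longrightarrow> Domain p \<subseteq> Z \<Longrightarrow> Domain (fill p Z k) = cl Z"
  unfolding fill_def using cl_superset[of Z] by blast

lemma fill_conds:
  assumes "finite Z" "Z \<subseteq> U" "finite p" "single_valued p" "Domain p \<subseteq> Z"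
  shows "fill p Z k \<in> conds"
proof -
  have "single_valued (fill p Z k)"
    using assms(4) unfolding fill_def single_valued_def by blast
  moreover have "finite (fill p Z k)"
    unfolding fill_def using assms(3) finite_cl[OF assms(1)] by simp
  moreover have "anc x (ht y) \<in> cl Z" if "x \<in> cl Z" "y \<in> cl Z" "ht y \<le> ht x" for x y
    using cl_anc[OF assms(2) that(1) _ that(3)] ht_cl[OF assms(2)] that(2) by blast
  ultimately show ?thesis
    unfolding conds_def using Domain_fill[OF assms(2,5)] cl_subset[OF assms(2)] by simp
qed

text \<open>In the applications \<open>p'\<close> is \<open>p\<close> or its union with another
  condition. By \<open>new\<close>, no node of \<open>p'\<close> at a level untouched by
  \<open>p\<close> is a restriction of a node of \<open>p\<close>, so labels found there can only be
  \<open>k\<close>.\<close>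

lemma fill_ext:
  assumes p: "p \<in> conds" "p \<subseteq> p'" and Z: "Z \<subseteq> U" "Domain p' \<subseteq> Z" and k: "k \<notin> Range p"
    and new: "\<And>x y. \<lbrakk>x \<in> Domain p; y \<in> Domain p'; ht y \<notin> ht ` Domain p; ht y \<le> ht x\<rbrakk> \<Longrightarrow> anc x (ht y) \<noteq> y"
  shows "ext (fill p' Z k) p"
  unfolding ext_def
proof (intro conjI ballI allI impI)
  show "p \<subseteq> fill p' Z k" using p(2) by (auto simp: fill_def)
  fix x y \<xi> l
  assume x: "x \<in> Domain p" "y \<in> Domain p" "\<xi> \<le> ht x" "\<xi> \<le> ht y" "\<xi> \<notin> ht ` Domain p"
    "(anc x \<xi>, l) \<in> fill p' Z k"
  have U: "x \<in> U" "y \<in> U" using x condsD(2)[OF p(1)] by blast+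
  have nd: "anc z \<xi> \<notin> Domain p'" if "z \<in> Domain p" "\<xi> \<le> ht z" for z
  proof
    assume "anc z \<xi> \<in> Domain p'"
    moreover have "ht (anc z \<xi>) = \<xi>" using ht_anc[OF _ that(2)] that(1) condsD(2)[OF p(1)] by blast
    ultimately show False using new[OF that(1), of "anc z \<xi>"] that(2) x(5) by simp
  qed
  have "l = k" "anc x \<xi> \<in> cl Z" using x(6) nd[OF x(1,3)] by (auto simp: fill_def)
  then have "\<xi> \<in> ht ` Z" using ht_cl[OF Z(1)] ht_anc[OF U(1) x(3)] by (metis imageI)
  have "y \<in> cl Z" using x(2) p(2) Z(2) cl_superset[OF Z(1)] by blast
  then have "anc y \<xi> \<in> cl Z" using cl_anc[OF Z(1) _ \<open>\<xi> \<in> ht ` Z\<close> x(4)] by blast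
  with nd[OF x(2,4)] \<open>l = k\<close> show "(anc y \<xi>, l) \<in> fill p' Z k" by (simp add: fill_def)
  show "l \<notin> Range p" using k \<open>l = k\<close> by simp
qed

text \<open>The union is closed up with one label fresh for both conditions; \<open>pq\<close> and
  \<open>qp\<close> supply the hypothesis \<open>new\<close> of \<open>fill_ext\<close> in the two
  directions.\<close>

lemma compatible_conds:
  assumes p: "p \<in> conds" and q: "q \<in> conds" and sv: "single_valued (p \<union> q)"
    and pq: "\<And>x y. \<lbrakk>x \<in> Domain p; y \<in> Domain q; ht y \<notin> ht ` Domain p; ht y \<le> ht x\<rbrakk> \<Longrightarrow> anc x (ht y) \<noteq> y"
    and qp: "\<And>x y. \<lbrakk>x \<in> Domain q; y \<in> Domain p; ht y \<notin> ht ` Domain q; ht y \<le> ht x\<rbrakk> \<Longrightarrow> anc x (ht y) \<noteq> y"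
  shows "compatible conds ext p q"
proof -
  have fin: "finite (p \<union> q)" using condsD(1)[OF p] condsD(1)[OF q] by simp
  then obtain k where k: "k \<notin> Range (p \<union> q)"
    using ex_new_if_finite[OF infinite_UNIV_nat finite_Range[OF fin]] by blast
  let ?r = "fill (p \<union> q) (Domain (p \<union> q)) k"
  have U: "Domain (p \<union> q) \<subseteq> U" using condsD(2)[OF p] condsD(2)[OF q] by blast
  have "?r \<in> conds" using fin U sv by (intro fill_conds finite_Domain) simp_all
  moreover have "ext ?r p"
    using k pq by (intro fill_ext[OF p _ U]) auto
  moreover have "ext ?r q"
    using k qp by (intro fill_ext[OF q _ U]) auto
  ultimately show ?thesis unfolding compatible_def by blast
qed

section \<open>The countable chain condition\<close>

lemma ex_other:
  assumes "uncountable B"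
  shows "\<exists>q\<in>B. q \<noteq> p"
proof (rule ccontr)
  assume "\<not> ?thesis"
  then have "B \<subseteq> {p}" by blast
  then have "countable B" by (rule countable_subset) simp
  with assms show False by contradiction
qed

text \<open>An uncountable antichain is thinned until nodes and levels form delta systems, labels on
  the root agree, and all levels outside the root lie above it. Then
  \<open>incomparable_pair\<close> yields two conditions to which \<open>compatible_conds\<close>
  applies.\<close>

lemma conds_ccc:
  assumes no_uncountable_chain
  shows "ccc conds ext"
  unfolding ccc_def
proof (intro allI impI, rule ccontr)
  fix A assume A: "A \<subseteq> conds" and anti: "\<forall>p\<in>A. \<forall>q\<in>A. p \<noteq> q \<longrightarrow> \<not> compatible conds ext p q"
    and uA: "uncountable A"
  have fin: "finite (Domain p)" if "p \<in> A" for p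
    using A that condsD(1) by (auto intro: finite_Domain)
  obtain B1 R1 where B1: "B1 \<subseteq> A" "uncountable B1"
    and R1: "\<And>p q. p \<in> B1 \<Longrightarrow> q \<in> B1 \<Longrightarrow> p \<noteq> q \<Longrightarrow> Domain p \<inter> Domain q = R1"
    by (rule delta_system[OF uA fin]) (simp_all, blast)
  have fin1: "finite (ht ` Domain p)" if "p \<in> B1" for p
    using fin that B1(1) by blast
  obtain B2 R2 where B2: "B2 \<subseteq> B1" "uncountable B2"
    and R2: "\<And>p q. p \<in> B2 \<Longrightarrow> q \<in> B2 \<Longrightarrow> p \<noteq> q \<Longrightarrow> ht ` Domain p \<inter> ht ` Domain q = R2"
    by (rule delta_system[OF B1(2) fin1]) (simp_all, blast)
  have R1_sub: "R1 \<subseteq> Domain p" and R2_sub: "R2 \<subseteq> ht ` Domain p" if p: "p \<in> B2" for p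
  proof -
    obtain q where q: "q \<in> B2" "q \<noteq> p" using ex_other[OF B2(2)] by blast
    with p B2(1) have "p \<in> B1" "q \<in> B1" by blast+
    from R1[OF this] R2[OF p q(1)] q(2) show "R1 \<subseteq> Domain p" "R2 \<subseteq> ht ` Domain p" by blast+
  qed
  obtain p0 where p0: "p0 \<in> B2" using ex_other[OF B2(2)] by blast
  have "p0 \<in> A" using p0 B1(1) B2(1) by blast
  have finR: "finite R1" "finite R2"
    using R1_sub[OF p0] R2_sub[OF p0] fin[OF \<open>p0 \<in> A\<close>] by (auto intro: finite_subset)
  \<comment> \<open>The finite root \<open>R1\<close> has only countably many labellings, so
    uncountably many conditions share one.\<close>
  have cnt: "countable ((\<lambda>p. p \<inter> R1 \<times> UNIV) ` B2)"
  proof (rule countable_subset)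
    show "countable (Fpow (R1 \<times> (UNIV :: nat set)))"
      using finR(1) by (intro countable_Fpow countable_SIGMA) (simp_all add: countable_finite)
    show "(\<lambda>p. p \<inter> R1 \<times> UNIV) ` B2 \<subseteq> Fpow (R1 \<times> UNIV)"
    proof (rule image_subsetI)
      fix p assume "p \<in> B2"
      then have "p \<in> conds" using A B1(1) B2(1) by blast
      then show "p \<inter> R1 \<times> UNIV \<in> Fpow (R1 \<times> UNIV)" using condsD(1) by (simp add: Fpow_def)
    qed
  qed
  obtain g where g: "uncountable {p \<in> B2. p \<inter> R1 \<times> UNIV = g}"
    by (rule uncountable_fiber[OF B2(2) cnt])
  define B3 where "B3 = {p \<in> B2. p \<inter> R1 \<times> UNIV = g}"
  obtain m where m: "\<forall>\<xi>\<in>R2. \<xi> < m"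
    using countable_omega1_bounded[OF countable_finite[OF finR(2)]] by blast
  define bad where "bad = (\<Union>\<xi>\<in>{..m} - R2. {p \<in> B3. \<xi> \<in> ht ` Domain p})"
  \<comment> \<open>A level outside \<open>R2\<close> is touched by at most one condition, so
    discarding the conditions with such a level up to \<open>m\<close> costs only countably
    many.\<close>
  have "countable {p \<in> B3. \<xi> \<in> ht ` Domain p}" if "\<xi> \<notin> R2" for \<xi>
  proof (rule ccontr)
    assume u: "\<not> ?thesis"
    obtain p where p: "p \<in> {p \<in> B3. \<xi> \<in> ht ` Domain p}"
      using ex_other[OF u, of "{}"] by (elim bexE)
    obtain q where q: "q \<in> {p \<in> B3. \<xi> \<in> ht ` Domain p}" "q \<noteq> p"
      using ex_other[OF u, of p] by (elim bexE)
    have "p \<in> B2" "q \<in> B2" using p q by (simp_all add: B3_def)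
    from R2[OF this] q p that show False by blast
  qed
  then have "countable bad"
    unfolding bad_def using countable_atMost_omega1[of m] by (intro countable_UN countable_Diff) simp_all
  moreover have "uncountable B3" using g by (simp add: B3_def)
  ultimately have uB4: "uncountable (B3 - bad)" by (rule uncountable_minus_countable[rotated])
  define B4 where "B4 = B3 - bad"
  have B4: "p \<in> A" "p \<in> B1" "p \<in> B2" "p \<inter> R1 \<times> UNIV = g" "p \<in> conds" "p \<notin> bad" if "p \<in> B4" for p
    using that A B1(1) B2(1) by (auto simp: B4_def B3_def)
  have high: "m < ht y" if "p \<in> B4" "y \<in> Domain p" "ht y \<notin> R2" for p y
  proof (rule ccontr)
    assume "\<not> m < ht y"
    then have "ht y \<in> {..m} - R2" "p \<in> {p \<in> B3. ht y \<in> ht ` Domain p}"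
      using that by (simp_all add: B4_def)
    then have "p \<in> bad" unfolding bad_def by (rule UN_I)
    with B4(6)[OF that(1)] show False by contradiction
  qed
  \<comment> \<open>These sets are disjoint because of their levels: outside \<open>R2\<close> two
    distinct conditions share none.\<close>
  define W where "W p = {x \<in> Domain p. ht x \<notin> R2}" for p :: "('a \<times> nat) set"
  have "\<exists>p\<in>B4. \<exists>q\<in>B4. p \<noteq> q \<and> (\<forall>x\<in>W p. \<forall>y\<in>W q. \<not> x \<sqsubset> y \<and> \<not> y \<sqsubset> x)"
  proof (rule incomparable_pair[OF assms])
    show "uncountable B4" using uB4 by (simp add: B4_def)
    show "finite (W p) \<and> W p \<subseteq> U" if "p \<in> B4" for p
      using fin[OF B4(1)[OF that]] condsD(2)[OF B4(5)[OF that]] by (auto simp: W_def)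
    show "W p \<inter> W q = {}" if "p \<in> B4" "q \<in> B4" "p \<noteq> q" for p q
      using R2[OF B4(3)[OF that(1)] B4(3)[OF that(2)] that(3)] by (auto simp: W_def)
  qed
  then obtain p q where pq: "p \<in> B4" "q \<in> B4" "p \<noteq> q"
    and inc: "\<And>x y. x \<in> W p \<Longrightarrow> y \<in> W q \<Longrightarrow> \<not> x \<sqsubset> y \<and> \<not> y \<sqsubset> x" by blast
  have key: "anc x (ht y) \<noteq> y"
    if pq: "p \<in> B4" "q \<in> B4" and inc: "\<And>x y. x \<in> W p \<Longrightarrow> y \<in> W q \<Longrightarrow> \<not> y \<sqsubset> x"
      and xy: "x \<in> Domain p" "y \<in> Domain q" "ht y \<notin> ht ` Domain p" "ht y \<le> ht x" for p q x y
  proof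
    assume eq: "anc x (ht y) = y"
    have "x \<in> U" using xy(1) condsD(2)[OF B4(5)[OF pq(1)]] by blast
    from anc_below[OF this xy(4)] eq have "y = x \<or> y \<sqsubset> x" by simp
    with xy(1,3) have "y \<sqsubset> x" by auto
    \<comment> \<open>The level of \<open>y\<close> is outside \<open>R2\<close>, hence above
      \<open>m\<close>, and the level of \<open>x\<close> is at least as high. So both nodes belong
      to the sets that were chosen incomparable.\<close>
    have "ht y \<notin> R2" using xy(3) R2_sub[OF B4(3)[OF pq(1)]] by blast
    moreover from high[OF pq(2) xy(2) this] xy(4) have "m < ht x" by simp
    then have "ht x \<notin> R2" using m by (meson less_asym)
    ultimately have "x \<in> W p" "y \<in> W q" using xy by (simp_all add: W_def)
    with inc \<open>y \<sqsubset> x\<close> show False by blast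
  qed
  have "single_valued (p \<union> q)"
  proof (rule single_valuedI)
    have agree: "k = l" if pq: "p \<in> B4" "q \<in> B4" "p \<noteq> q" and kl: "(x, k) \<in> p" "(x, l) \<in> q" for p q x k l
    proof -
      have "x \<in> R1" using R1[OF B4(2)[OF pq(1)] B4(2)[OF pq(2)] pq(3)] kl by blast
      with kl B4(4)[OF pq(1)] B4(4)[OF pq(2)] have "(x, k) \<in> q" by blast
      with kl(2) condsD(3)[OF B4(5)[OF pq(2)]] show ?thesis by (meson single_valuedD)
    qed
    fix x k l assume "(x, k) \<in> p \<union> q" "(x, l) \<in> p \<union> q"
    then show "k = l"
      using agree[OF pq(1,2)] agree[OF pq(2,1)] pq(3)
        condsD(3)[OF B4(5)[OF pq(1)]] condsD(3)[OF B4(5)[OF pq(2)]]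
      by (metis Un_iff single_valuedD)
  qed
  then have "compatible conds ext p q"
    using B4(5) pq(1,2) by (intro compatible_conds key[OF pq(1,2)] key[OF pq(2,1)]) (use inc in blast)+
  with anti B4(1) pq show False by blast
qed

end

section \<open>A coherent labelling from Martin's Axiom\<close>

text \<open>\<open>MA_omega1\<close> speaks of posets on one fixed type. A poset that injects into
  that type is moved there along \<open>e\<close>, and the filter is pulled back.\<close>

lemma MA_omega1_transfer:
  fixes P :: "'p set" and e :: "'p \<Rightarrow> 'a"
  assumes MA: "MA_omega1 TYPE('a)" and e: "inj_on e P"
    and po: "is_poset P le" and ne: "P \<noteq> {}" and ccc: "ccc P le"
    and dense: "\<And>D. D \<in> \<D> \<Longrightarrow> dense_in P le D" and card: "|\<D>| \<le>o cardSuc natLeq"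
  shows "\<exists>G. is_filter P le G \<and> (\<forall>D\<in>\<D>. G \<inter> D \<noteq> {})"
proof -
  define g where "g = inv_into P e"
  define le' where "le' a b = le (g a) (g b)" for a b
  have g: "g (e p) = p" if "p \<in> P" for p
    using e that by (simp add: g_def)
  have po': "is_poset (e ` P) le'"
  proof -
    have le: "le' (e p) (e q) \<longleftrightarrow> le p q" if "p \<in> P" "q \<in> P" for p q
      using that by (simp add: le'_def g)
    have refl: "le p p" if "p \<in> P" for p
      using po that unfolding is_poset_def by blast
    have anti: "p = q" if "p \<in> P" "q \<in> P" "le p q" "le q p" for p q
      using po that unfolding is_poset_def by blast
    have trans: "le p r" if "p \<in> P" "q \<in> P" "r \<in> P" "le p q" "le q r" for p q r
      using po that unfolding is_poset_def by blast
    show ?thesis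
      unfolding is_poset_def
    proof (intro conjI ballI impI; elim imageE; hypsubst)
      show "le' (e p) (e p)" if "p \<in> P" for p using that le refl by simp
      show "e p = e q" if "p \<in> P" "q \<in> P" "le' (e p) (e q)" "le' (e q) (e p)" for p q
        using that le anti by blast
      show "le' (e p) (e r)" if "le' (e p) (e q)" "le' (e q) (e r)" "p \<in> P" "q \<in> P" "r \<in> P" for p q r
        using that le trans by blast
    qed
  qed
  have ccc': "ccc (e ` P) le'"
    unfolding ccc_def
  proof (intro allI impI)
    fix A assume A: "A \<subseteq> e ` P" and inc: "\<forall>p\<in>A. \<forall>q\<in>A. p \<noteq> q \<longrightarrow> \<not> compatible (e ` P) le' p q"
    have gA: "g a \<in> P" "e (g a) = a" if "a \<in> A" for a
      using that A g by auto
    have "countable (g ` A)"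
    proof (rule ccc[unfolded ccc_def, rule_format])
      show "g ` A \<subseteq> P" using gA by blast
      fix p q assume pq: "p \<in> g ` A" "q \<in> g ` A" "p \<noteq> q"
      show "\<not> compatible P le p q"
      proof
        assume "compatible P le p q"
        then obtain r where r: "r \<in> P" "le r p" "le r q" unfolding compatible_def by blast
        from pq obtain a b where ab: "a \<in> A" "b \<in> A" "p = g a" "q = g b" by blast
        with r g have "compatible (e ` P) le' a b"
          unfolding compatible_def le'_def by (intro bexI[of _ "e r"]) auto
        moreover have "a \<noteq> b" using ab(3,4) pq(3) by blast
        ultimately show False using inc ab(1,2) by simp
      qed
    qed
    moreover have "inj_on g A" using gA(2) by (rule inj_on_inverseI)
    ultimately show "countable A" by (rule countable_image_inj_on)
  qed
  have dense': "dense_in (e ` P) le' D" if "D \<in> (`) e ` \<D>" for D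
  proof -
    from that obtain E where E: "E \<in> \<D>" "D = e ` E" by blast
    from dense[OF E(1)] have EP: "E \<subseteq> P" "\<And>p. p \<in> P \<Longrightarrow> \<exists>q\<in>E. le q p"
      unfolding dense_in_def by blast+
    show ?thesis unfolding dense_in_def
    proof (intro conjI ballI)
      show "D \<subseteq> e ` P" using E EP by blast
      fix a assume "a \<in> e ` P"
      then obtain p where p: "p \<in> P" "a = e p" by blast
      from EP(2)[OF p(1)] obtain q where "q \<in> E" "le q p" by blast
      then have "le' (e q) a" using p g EP(1) by (simp add: le'_def subset_iff)
      moreover have "e q \<in> D" using E(2) \<open>q \<in> E\<close> by blast
      ultimately show "\<exists>b\<in>D. le' b a" by blast
    qed
  qed
  have card': "|(`) e ` \<D>| \<le>o cardSuc natLeq"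
    using card_of_image card by (rule ordLeq_transitive)
  have "e ` P \<noteq> {}" using ne by simp
  have "\<exists>G. is_filter (e ` P) le' G \<and> (\<forall>D\<in>(`) e ` \<D>. G \<inter> D \<noteq> {})"
    by (rule MA[unfolded MA_omega1_def, rule_format, OF po' \<open>e ` P \<noteq> {}\<close> ccc' _ card']) (rule dense')
  then obtain G where G: "is_filter (e ` P) le' G" "\<forall>D\<in>(`) e ` \<D>. G \<inter> D \<noteq> {}" by blast
  let ?H = "{p \<in> P. e p \<in> G}"
  have GP: "G \<subseteq> e ` P" and Gne: "G \<noteq> {}"
    and up: "\<And>p q. p \<in> G \<Longrightarrow> q \<in> e ` P \<Longrightarrow> le' p q \<Longrightarrow> q \<in> G"
    and dir: "\<And>p q. p \<in> G \<Longrightarrow> q \<in> G \<Longrightarrow> \<exists>r\<in>G. le' r p \<and> le' r q"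
    using G(1) unfolding is_filter_def by blast+
  have "is_filter P le ?H"
    unfolding is_filter_def
  proof (intro conjI ballI impI)
    show "?H \<subseteq> P" by blast
    show "?H \<noteq> {}" using GP Gne by blast
    fix p q assume p: "p \<in> ?H"
    show "q \<in> ?H" if "q \<in> P" "le p q"
      using up[of "e p" "e q"] p that by (simp add: le'_def g)
    assume q: "q \<in> ?H"
    with p obtain r where r: "r \<in> G" "le' r (e p)" "le' r (e q)" using dir by blast
    then obtain s where "s \<in> P" "r = e s" using GP by blast
    with r p q show "\<exists>r\<in>?H. le r p \<and> le r q" by (intro bexI[of _ s]) (simp_all add: le'_def g)
  qed
  moreover have "?H \<inter> D \<noteq> {}" if "D \<in> \<D>" for D
  proof -
    have "G \<inter> e ` D \<noteq> {}" using G(2) that by blast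
    then obtain d where "d \<in> D" "e d \<in> G" by blast
    moreover have "D \<subseteq> P" using dense[OF that] unfolding dense_in_def by blast
    ultimately show ?thesis by blast
  qed
  ultimately show ?thesis by blast
qed

context tree_ht
begin

text \<open>Conditions are finite subsets of the product of \<open>U\<close> with the natural
  numbers, and there are at most \<open>|U|\<close> of these. So Martin's Axiom for posets on the
  type of \<open>U\<close> applies to them.\<close>

lemma conds_embed:
  assumes "infinite U"
  shows "\<exists>e :: ('a \<times> nat) set \<Rightarrow> 'a. inj_on e conds"
proof -
  have "|UNIV :: nat set| \<le>o |U|" using assms infinite_iff_card_of_nat by blast
  then have le: "|U \<times> (UNIV :: nat set)| \<le>o |U|"
    using assms by (intro card_of_Times_ordLeq_infinite_Field card_of_Card_order card_of_mono1)
      (simp_all add: Field_card_of)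
  have "U \<noteq> {}" using assms by auto
  then have "infinite (U \<times> (UNIV :: nat set))" by (simp add: finite_cartesian_product_iff)
  then have "|Fpow (U \<times> (UNIV :: nat set))| \<le>o |U \<times> (UNIV :: nat set)|" by (rule finite_subsets_le)
  moreover have "conds \<subseteq> Fpow (U \<times> UNIV)" by (auto simp: Fpow_def conds_def)
  then have "|conds| \<le>o |Fpow (U \<times> (UNIV :: nat set))|" by (rule card_of_mono1)
  ultimately have "|conds| \<le>o |U|" using le by (blast intro: ordLeq_transitive)
  then show ?thesis unfolding card_of_ordLeq[symmetric] by blast
qed

section \<open>Dense sets and the generic labelling\<close>

lemma dense_Domain:
  assumes "x \<in> U"
  shows "dense_in conds ext {p \<in> conds. x \<in> Domain p}"
  unfolding dense_in_def
proof (intro conjI ballI)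
  fix p assume p: "p \<in> conds"
  let ?Z = "insert x (Domain p)"
  have fin: "finite p" using condsD(1)[OF p] .
  obtain k where k: "k \<notin> Range p"
    using ex_new_if_finite[OF infinite_UNIV_nat finite_Range[OF fin]] by blast
  have Z: "?Z \<subseteq> U" "finite ?Z" using assms condsD(2)[OF p] fin by (simp_all add: finite_Domain)
  have "fill p ?Z k \<in> conds" using Z fin condsD(3)[OF p] by (intro fill_conds) auto
  moreover have "ext (fill p ?Z k) p"
    by (rule fill_ext[OF p subset_refl Z(1) _ k]) auto
  moreover have "x \<in> Domain (fill p ?Z k)"
    using Domain_fill[OF Z(1), of p k] cl_superset[OF Z(1)] by blast
  ultimately show "\<exists>q\<in>{p \<in> conds. x \<in> Domain p}. ext q p" by blast
qed simp

definition coherent_labelling :: "('a \<Rightarrow> nat) \<Rightarrow> bool" where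
  "coherent_labelling F \<longleftrightarrow>
     (\<forall>x\<in>U. \<forall>y\<in>U. finite {\<xi>. \<xi> \<le> ht x \<and> \<xi> \<le> ht y \<and> F (anc x \<xi>) \<noteq> F (anc y \<xi>)}) \<and>
     (\<forall>x\<in>U. \<forall>k. finite {\<xi>. \<xi> \<le> ht x \<and> F (anc x \<xi>) = k})"

text \<open>Take a condition of the filter with \<open>x\<close> and \<open>y\<close> in its domain:
  \<open>ext\<close> forces their labels to agree off its finitely many levels. If its domain
  contains \<open>x\<close> and its range \<open>k\<close>, then \<open>k\<close> does not label
  restrictions of \<open>x\<close> off those levels.\<close>

lemma ex_coherent_labelling:
  assumes MA: "MA_omega1 TYPE('a)" and nc: no_uncountable_chain
    and inf: "infinite U" and size: "|U| \<le>o cardSuc natLeq"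
  shows "\<exists>F. coherent_labelling F"
proof -
  let ?D = "\<lambda>x. {p \<in> conds. x \<in> Domain p}"
  obtain e :: "('a \<times> nat) set \<Rightarrow> 'a" where e: "inj_on e conds" using conds_embed[OF inf] by blast
  have "\<exists>G. is_filter conds ext G \<and> (\<forall>D\<in>?D ` U. G \<inter> D \<noteq> {})"
  proof (rule MA_omega1_transfer[OF MA e poset_conds _ conds_ccc[OF nc]])
    have "{} \<in> conds" by (simp add: conds_def single_valued_def)
    then show "conds \<noteq> {}" by blast
    show "|?D ` U| \<le>o cardSuc natLeq" using card_of_image size by (rule ordLeq_transitive)
    show "dense_in conds ext D" if "D \<in> ?D ` U" for D
      using that by (elim imageE) (simp only: dense_Domain)
  qed
  then obtain G where filter: "is_filter conds ext G" and meets: "\<forall>D\<in>?D ` U. G \<inter> D \<noteq> {}"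
    by (elim exE conjE) (rule that)
  have GP: "G \<subseteq> conds" and dir: "\<And>p q. p \<in> G \<Longrightarrow> q \<in> G \<Longrightarrow> \<exists>r\<in>G. ext r p \<and> ext r q"
    using filter unfolding is_filter_def by blast+
  have total: "\<exists>p\<in>G. x \<in> Domain p" if "x \<in> U" for x
  proof -
    have "G \<inter> ?D x \<noteq> {}" by (rule bspec[OF meets imageI[OF that]])
    then obtain p where "p \<in> G \<inter> ?D x" by fast
    then show ?thesis by (intro bexI[of _ p]) simp_all
  qed
  define F where "F x = (SOME k. \<exists>p\<in>G. (x, k) \<in> p)" for x
  have F: "F x = k" if "p \<in> G" "(x, k) \<in> p" for x k p
  proof -
    have "\<exists>p\<in>G. (x, F x) \<in> p" unfolding F_def
      by (rule someI[of "\<lambda>k. \<exists>p\<in>G. (x, k) \<in> p" k]) (use that in blast)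
    then obtain q where q: "q \<in> G" "(x, F x) \<in> q" by blast
    from dir[OF that(1) q(1)] obtain r where r: "r \<in> G" "ext r p" "ext r q" by blast
    have "(x, k) \<in> r" "(x, F x) \<in> r"
      using extD(1)[OF r(2)] extD(1)[OF r(3)] that(2) q(2) by blast+
    moreover have "single_valued r" using condsD(3) GP r(1) by blast
    ultimately show ?thesis by (meson single_valuedD)
  qed
  \<comment> \<open>Some \<open>q\<close> in the filter labels \<open>anc x \<xi>\<close>; a common
    extension \<open>r\<close> of \<open>p\<close> and \<open>q\<close> carries that label and obeys
    \<open>ext r p\<close>.\<close>
  have key: "F (anc x \<xi>) = F (anc y \<xi>) \<and> F (anc x \<xi>) \<notin> Range p"
    if p: "p \<in> G" and x: "x \<in> Domain p" "y \<in> Domain p" "\<xi> \<le> ht x" "\<xi> \<le> ht y" "\<xi> \<notin> ht ` Domain p" for p x y \<xi>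
  proof -
    have "p \<in> conds" using p GP by blast
    then have "x \<in> U" using condsD(2) x(1) by blast
    then have "anc x \<xi> \<in> U" using x(3) by (rule anc_in)
    from total[OF this] obtain q k where q: "q \<in> G" "(anc x \<xi>, k) \<in> q" by blast
    from dir[OF p q(1)] obtain r where r: "r \<in> G" "ext r p" "ext r q" by blast
    have in_r: "(anc x \<xi>, k) \<in> r" using extD(1)[OF r(3)] q(2) by blast
    from extD(2)[OF r(2) x in_r] have "k \<notin> Range p" "(anc y \<xi>, k) \<in> r" by simp_all
    with F[OF r(1) in_r] F[OF r(1), of "anc y \<xi>" k] show ?thesis by simp
  qed
  have both: "\<exists>p\<in>G. p1 \<subseteq> p \<and> p2 \<subseteq> p" if "p1 \<in> G" "p2 \<in> G" for p1 p2
    using dir[OF that] extD(1) by blast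
  have fin: "finite (ht ` Domain p)" if "p \<in> G" for p
    using that GP condsD(1) by (blast intro: finite_Domain)
  have "finite {\<xi>. \<xi> \<le> ht x \<and> \<xi> \<le> ht y \<and> F (anc x \<xi>) \<noteq> F (anc y \<xi>)}" if xy: "x \<in> U" "y \<in> U" for x y
  proof -
    obtain p1 p2 where "p1 \<in> G" "x \<in> Domain p1" "p2 \<in> G" "y \<in> Domain p2" using total xy by blast
    moreover from this obtain p where "p \<in> G" "p1 \<subseteq> p" "p2 \<subseteq> p" using both by blast
    ultimately have p: "p \<in> G" "x \<in> Domain p" "y \<in> Domain p" by blast+
    have "{\<xi>. \<xi> \<le> ht x \<and> \<xi> \<le> ht y \<and> F (anc x \<xi>) \<noteq> F (anc y \<xi>)} \<subseteq> ht ` Domain p"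
      using key[OF p] by blast
    then show ?thesis using fin[OF p(1)] by (rule finite_subset)
  qed
  moreover have "finite {\<xi>. \<xi> \<le> ht x \<and> F (anc x \<xi>) = k}" if x: "x \<in> U" for x k
  proof (cases "\<exists>q\<in>G. k \<in> Range q")
    case True
    then obtain p2 where p2: "p2 \<in> G" "k \<in> Range p2" by blast
    obtain p1 where p1: "p1 \<in> G" "x \<in> Domain p1" using total x by blast
    from both[OF p1(1) p2(1)] obtain p where "p \<in> G" "p1 \<subseteq> p" "p2 \<subseteq> p" by blast
    with p1 p2 have p: "p \<in> G" "x \<in> Domain p" "k \<in> Range p" by blast+
    have "{\<xi>. \<xi> \<le> ht x \<and> F (anc x \<xi>) = k} \<subseteq> ht ` Domain p"
      using key[OF p(1,2,2)] p(3) by blast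
    then show ?thesis using fin[OF p(1)] by (rule finite_subset)
  next
    case False
    have "F (anc x \<xi>) \<noteq> k" if "\<xi> \<le> ht x" for \<xi>
    proof -
      from total[OF anc_in[OF x that]] obtain q l where q: "q \<in> G" "(anc x \<xi>, l) \<in> q" by blast
      with F[OF q] False show ?thesis by blast
    qed
    then have "{\<xi>. \<xi> \<le> ht x \<and> F (anc x \<xi>) = k} = {}" by blast
    then show ?thesis by (simp only: finite.emptyI)
  qed
  ultimately show ?thesis unfolding coherent_labelling_def by blast
qed

end

section \<open>Heights\<close>

text \<open>The ordinal \<open>\<alpha>\<close> as a reflexive well-order relation, the form in
  which \<open>height_omega1\<close> compares order types.\<close>

definition seg :: "omega1 \<Rightarrow> omega1 rel" where
  "seg \<alpha> = {(\<xi>, \<eta>). \<xi> \<le> \<eta> \<and> \<eta> < \<alpha>}"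

lemma Field_seg: "Field (seg \<alpha>) = {..<\<alpha>}"
  by (auto simp: seg_def Field_def)

lemma wf_strict: "wf {(\<xi> :: omega1, \<eta>). \<xi> < \<eta>}"
  by (rule wellorder_class.wf)

lemma Well_order_seg: "Well_order (seg \<alpha>)"
proof -
  have "wf (seg \<alpha> - Id)"
    by (rule wf_subset[OF wf_strict]) (auto simp: seg_def)
  then show ?thesis
    unfolding order_on_defs Field_seg
    by (auto simp: refl_on_def trans_def antisym_def total_on_def seg_def)
qed

text \<open>An embedding is strictly increasing, so \<open>\<xi> \<le> f \<xi>\<close> by induction;
  for \<open>\<beta> < \<alpha>\<close> this contradicts \<open>f \<beta> < \<beta>\<close>.\<close>

lemma seg_le_imp_le:
  assumes "seg \<alpha> \<le>o seg \<beta>"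
  shows "\<alpha> \<le> \<beta>"
proof (rule ccontr)
  assume "\<not> \<alpha> \<le> \<beta>"
  then have ba: "\<beta> < \<alpha>" by simp
  from assms obtain f where f: "embed (seg \<alpha>) (seg \<beta>) f" unfolding ordLeq_def by auto
  have inj: "inj_on f {..<\<alpha>}" using embed_inj_on[OF Well_order_seg f] by (simp add: Field_seg)
  have mono: "f \<xi> \<le> f \<eta>" if "\<xi> \<le> \<eta>" "\<eta> < \<alpha>" for \<xi> \<eta>
    using embed_compat[OF f] that unfolding compat_def seg_def by blast
  have "\<xi> \<le> f \<xi>" if "\<xi> < \<alpha>" for \<xi>
    using that
  proof (induction \<xi> rule: less_induct)
    case (less \<xi>)
    show ?case
    proof (rule leI, rule notI)
      assume l: "f \<xi> < \<xi>"
      then have "f \<xi> < \<alpha>" using less.prems by (rule less_trans)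
      then have "f \<xi> \<le> f (f \<xi>)" using less.IH[OF l] by simp
      moreover have "f (f \<xi>) \<le> f \<xi>" using mono l less.prems by simp
      ultimately have "f (f \<xi>) = f \<xi>" by simp
      then show False using inj_onD[OF inj, of "f \<xi>" \<xi>] l less.prems \<open>f \<xi> < \<alpha>\<close> by simp
    qed
  qed
  from this[OF ba] have "\<beta> \<le> f \<beta>" .
  moreover have "f \<beta> < \<beta>" using embed_Field[OF f] ba unfolding Field_seg by auto
  ultimately show False by simp
qed

context tree_ht
begin

lemma Field_pred_rel: "Field (pred_rel U (\<sqsubset>) x) = {y \<in> U. y \<sqsubset> x}"
  by (auto simp: pred_rel_def pred_set_def Field_def)

lemma Well_order_pred_rel:
  assumes "x \<in> U"
  shows "Well_order (pred_rel U (\<sqsubset>) x)"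
proof -
  let ?r = "pred_rel U (\<sqsubset>) x"
  have "?r - Id \<subseteq> inv_image {(\<xi>, \<eta>). \<xi> < \<eta>} ht"
    by (auto simp: pred_rel_def pred_set_def ht_less)
  then have "wf (?r - Id)" by (rule wf_subset[OF wf_inv_image[OF wf_strict]])
  moreover have "refl_on {y \<in> U. y \<sqsubset> x} ?r"
    by (auto simp: refl_on_def pred_rel_def pred_set_def)
  moreover have "trans ?r"
    unfolding trans_def pred_rel_def pred_set_def using lt_trans by blast
  moreover have "antisym ?r"
  proof (rule antisymI)
    fix y z assume "(y, z) \<in> ?r" "(z, y) \<in> ?r"
    then show "y = z"
      using ht_less[of y z] ht_less[of z y] by (auto simp: pred_rel_def pred_set_def)
  qed
  moreover have "total_on {y \<in> U. y \<sqsubset> x} ?r"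
    unfolding total_on_def pred_rel_def pred_set_def using lt_linear assms by blast
  moreover have "?r \<subseteq> {y \<in> U. y \<sqsubset> x} \<times> {y \<in> U. y \<sqsubset> x}"
    by (auto simp: pred_rel_def pred_set_def)
  ultimately show ?thesis unfolding order_on_defs Field_pred_rel by blast
qed

lemma is_tree: "is_tree U (\<sqsubset>)"
  unfolding is_tree_def
proof (intro conjI ballI impI)
  show "\<not> x \<sqsubset> x" if "x \<in> U" for x using ht_less[OF that that] by blast
qed (rule lt_trans Well_order_pred_rel; assumption)+

text \<open>The height map itself is the isomorphism.\<close>

lemma pred_rel_seg:
  assumes x: "x \<in> U"
  shows "pred_rel U (\<sqsubset>) x =o seg (ht x)"
proof -
  let ?P = "{y \<in> U. y \<sqsubset> x}"
  have "inj_on ht ?P" using x by (auto intro!: inj_onI anc_unique[of x])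
  moreover have "ht ` ?P = {..<ht x}" using ht_less[OF _ x] ht_onto[OF x] by fastforce
  moreover have "(y, z) \<in> pred_rel U (\<sqsubset>) x \<longleftrightarrow> (ht y, ht z) \<in> seg (ht x)"
    if "y \<in> ?P" "z \<in> ?P" for y z
  proof -
    have yz: "y \<in> U" "z \<in> U" "y \<sqsubset> x" "z \<sqsubset> x" using that by simp_all
    then show ?thesis
      using lt_linear[OF yz(1,2) x yz(3,4)] ht_less[OF yz(1,2)] ht_less[OF yz(2,1)] ht_less[OF yz(2) x]
      by (auto simp: seg_def pred_rel_def pred_set_def)
  qed
  ultimately have "iso (pred_rel U (\<sqsubset>) x) (seg (ht x)) ht"
    unfolding iso_iff2 Field_seg Field_pred_rel bij_betw_def by blast
  then show ?thesis
    unfolding ordIso_def using Well_order_pred_rel[OF x] Well_order_seg by blast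
qed

lemma ht_unbounded:
  assumes "height_omega1 U (\<sqsubset>)"
  shows "\<exists>x\<in>U. \<alpha> \<le> ht x"
proof -
  \<comment> \<open>\<open>height_omega1\<close> tests only well-orders on the natural numbers, so
    the countable segment is copied there.\<close>
  obtain g :: "omega1 \<Rightarrow> nat" where "inj_on g {..<\<alpha>}"
    using countable_lessThan_omega1[of \<alpha>] by (auto simp: countable_def)
  then have g: "inj_on g (Field (seg \<alpha>))" by (simp add: Field_seg)
  have W: "seg \<alpha> =o dir_image (seg \<alpha>) g" by (rule dir_image_ordIso[OF Well_order_seg g])
  then have "Well_order (dir_image (seg \<alpha>) g)" unfolding ordIso_def by simp
  with assms obtain x where x: "x \<in> U" "dir_image (seg \<alpha>) g \<le>o pred_rel U (\<sqsubset>) x"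
    unfolding height_omega1_def by blast
  have "seg \<alpha> \<le>o seg (ht x)"
    using ordLeq_ordIso_trans[OF ordIso_ordLeq_trans[OF W x(2)] pred_rel_seg[OF x(1)]] .
  then have "\<alpha> \<le> ht x" by (rule seg_le_imp_le)
  with x(1) show ?thesis by blast
qed

end

text \<open>By recursion, \<open>ht x\<close> is the least ordinal that is not the height of a
  predecessor; it exists because there are only countably many predecessors.\<close>

lemma ex_height:
  fixes U :: "'a set"
  assumes tree: "is_tree U lt" and cnt: "\<And>x. x \<in> U \<Longrightarrow> countable (pred_set U lt x)"
  shows "\<exists>ht. tree_ht U lt ht"
proof -
  have irr: "\<not> lt x x" if "x \<in> U" for x using tree that unfolding is_tree_def by blast
  have trans: "lt x z" if "x \<in> U" "y \<in> U" "z \<in> U" "lt x y" "lt y z" for x y z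
    using tree that unfolding is_tree_def by blast
  have wo: "Well_order (pred_rel U lt x)" if "x \<in> U" for x
    using tree that unfolding is_tree_def by blast
  have Field: "Field (pred_rel U lt x) = pred_set U lt x" for x
    by (auto simp: pred_rel_def Field_def)
  have lin: "x = y \<or> lt x y \<or> lt y x" if "x \<in> U" "y \<in> U" "z \<in> U" "lt x z" "lt y z" for x y z
  proof -
    have "total_on (pred_set U lt z) (pred_rel U lt z)"
      using wo[OF that(3)] unfolding order_on_defs Field by blast
    moreover have "x \<in> pred_set U lt z" "y \<in> pred_set U lt z" using that by (simp_all add: pred_set_def)
    ultimately show ?thesis unfolding total_on_def pred_rel_def by blast
  qed
  define R where "R = {(y, x). x \<in> U \<and> y \<in> U \<and> lt y x}"
  have wfR: "wf R"
  proof (rule wfI_min)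
    fix x :: 'a and Q assume x: "x \<in> Q"
    show "\<exists>z\<in>Q. \<forall>y. (y, z) \<in> R \<longrightarrow> y \<notin> Q"
    proof (cases "\<exists>y\<in>Q. (y, x) \<in> R")
      case False
      with x show ?thesis by blast
    next
      case True
      then obtain y where y: "y \<in> Q" "x \<in> U" "y \<in> pred_set U lt x" unfolding R_def pred_set_def by blast
      \<comment> \<open>A minimal element of \<open>Q\<close> among the predecessors of
        \<open>x\<close> is minimal in all of \<open>Q\<close>, since anything below it is again a
        predecessor of \<open>x\<close>.\<close>
      have "wf (pred_rel U lt x - Id)" using wo[OF y(2)] unfolding order_on_defs by blast
      moreover have "y \<in> Q \<inter> pred_set U lt x" using y by blast
      ultimately obtain z where z: "z \<in> Q \<inter> pred_set U lt x"
        and min: "\<And>w. (w, z) \<in> pred_rel U lt x - Id \<Longrightarrow> w \<notin> Q \<inter> pred_set U lt x"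
        by (rule wfE_min) blast
      have "w \<notin> Q" if w: "(w, z) \<in> R" for w
      proof -
        have "w \<in> U" "lt w z" "z \<in> U" "lt z x" using w z unfolding R_def pred_set_def by auto
        then have "lt w x" "w \<noteq> z" using trans[of w z x] y(2) irr by auto
        then have "w \<in> pred_set U lt x" using \<open>w \<in> U\<close> by (simp add: pred_set_def)
        moreover from this have "(w, z) \<in> pred_rel U lt x - Id"
          using z \<open>lt w z\<close> \<open>w \<noteq> z\<close> by (simp add: pred_rel_def)
        ultimately show ?thesis using min by blast
      qed
      with z show ?thesis by blast
    qed
  qed
  define H where "H f x = (LEAST w :: omega1. w \<notin> f ` pred_set U lt x)" for f x
  define ht where "ht = wfrec R H"
  have ht: "ht x = (LEAST w. w \<notin> ht ` pred_set U lt x)" if x: "x \<in> U" for x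
  proof -
    have "ht x = H (cut ht R x) x" unfolding ht_def by (rule wfrec[OF wfR])
    moreover have "cut ht R x ` pred_set U lt x = ht ` pred_set U lt x"
      using x by (intro image_cong) (auto simp: cut_def R_def pred_set_def)
    ultimately show ?thesis by (simp add: H_def)
  qed
  have notin: "ht x \<notin> ht ` pred_set U lt x" if x: "x \<in> U" for x
  proof -
    have "ht ` pred_set U lt x \<noteq> UNIV" using countable_image[OF cnt[OF x], of ht] uncountable_omega1 by auto
    then have "\<exists>w. w \<notin> ht ` pred_set U lt x" by blast
    from LeastI_ex[OF this] show ?thesis by (subst ht[OF x])
  qed
  have onto: "\<xi> \<in> ht ` pred_set U lt x" if "x \<in> U" "\<xi> < ht x" for x \<xi>
    using not_less_Least[of \<xi> "\<lambda>w. w \<notin> ht ` pred_set U lt x"] that ht[OF that(1)] by simp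
  show ?thesis
  proof (intro exI tree_ht.intro)
    show "ht x < ht y" if xy: "x \<in> U" "y \<in> U" "lt x y" for x y
    proof (rule ccontr)
      assume "\<not> ht x < ht y"
      moreover have "ht x \<in> ht ` pred_set U lt y" using xy by (intro imageI) (simp add: pred_set_def)
      then have "ht x \<noteq> ht y" using notin[OF xy(2)] by metis
      ultimately have "ht y < ht x" by simp
      from onto[OF xy(1) this] obtain z where "z \<in> pred_set U lt x" "ht y = ht z" by blast
      moreover from this have "z \<in> pred_set U lt y" using trans[of z x y] xy by (simp add: pred_set_def)
      ultimately have "ht y \<in> ht ` pred_set U lt y" by blast
      with notin[OF xy(2)] show False by contradiction
    qed
    show "\<exists>y\<in>U. lt y x \<and> ht y = \<xi>" if "x \<in> U" "\<xi> < ht x" for x \<xi>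
      using onto[OF that] by (auto simp: pred_set_def)
  qed (use trans lin in blast)+
qed

section \<open>The tree of labels\<close>

locale labelled_tree = tree_ht U lt ht
  for U :: "'a set" and lt (infix \<open>\<sqsubset>\<close> 50) and ht +
  fixes F :: "'a \<Rightarrow> nat"
  assumes labelling: "coherent_labelling F"
    and unbounded: "\<exists>x\<in>U. \<alpha> \<le> ht x"
begin

definition label :: "'a \<Rightarrow> omega1 \<Rightarrow> nat" where
  "label x \<xi> = F (anc x \<xi>)"

lemma finite_disagreement:
  assumes "x \<in> U" "y \<in> U"
  shows "finite {\<xi>. \<xi> \<le> ht x \<and> \<xi> \<le> ht y \<and> label x \<xi> \<noteq> label y \<xi>}"
  using labelling assms unfolding coherent_labelling_def label_def by simp

lemma finite_label:
  assumes "x \<in> U"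
  shows "finite {\<xi>. \<xi> \<le> ht x \<and> label x \<xi> = k}"
  using labelling assms unfolding coherent_labelling_def label_def by simp

lemma label_anc: "\<lbrakk>x \<in> U; \<xi> \<le> \<eta>; \<eta> \<le> ht x\<rbrakk> \<Longrightarrow> label (anc x \<eta>) \<xi> = label x \<xi>"
  by (simp add: label_def anc_anc)

text \<open>Sequences that agree pairwise would glue to one function on all of \<omega>1. Some value
  is taken uncountably often, hence infinitely often below some member of \<open>S\<close>, although
  label sequences are finite-to-one.\<close>

lemma exists_label_disagreement:
  assumes S: "uncountable S" and a: "\<And>\<alpha>. \<alpha> \<in> S \<Longrightarrow> a \<alpha> \<in> U \<and> \<alpha> \<le> ht (a \<alpha>)"
  shows "\<exists>\<alpha>\<in>S. \<exists>\<beta>\<in>S. \<alpha> < \<beta> \<and> (\<exists>\<xi><\<alpha>. label (a \<alpha>) \<xi> \<noteq> label (a \<beta>) \<xi>)"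
proof (rule ccontr)
  assume "\<not> ?thesis"
  then have agree: "label (a \<alpha>) \<xi> = label (a \<beta>) \<xi>"
    if "\<alpha> \<in> S" "\<beta> \<in> S" "\<alpha> < \<beta>" "\<xi> < \<alpha>" for \<alpha> \<beta> \<xi>
    using that by blast
  have "\<forall>\<xi>. \<exists>\<alpha>. \<alpha> \<in> S \<and> \<xi> < \<alpha>" using uncountable_omega1_unbounded[OF S] by metis
  from choice[OF this] obtain up where up: "\<And>\<xi>. up \<xi> \<in> S" "\<And>\<xi>. \<xi> < up \<xi>" by blast
  \<comment> \<open>The glued sequence; at level \<open>\<xi>\<close> any member of \<open>S\<close>
    above \<open>\<xi>\<close> gives the same value.\<close>
  define c where "c \<xi> = label (a (up \<xi>)) \<xi>" for \<xi>
  have c: "c \<xi> = label (a \<alpha>) \<xi>" if \<alpha>: "\<alpha> \<in> S" "\<xi> < \<alpha>" for \<alpha> \<xi>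
    using agree[OF \<alpha>(1) up(1)[of \<xi>] _ \<alpha>(2)] agree[OF up(1) \<alpha>(1) _ up(2)]
    unfolding c_def by (cases "up \<xi>" \<alpha> rule: linorder_cases) simp_all
  obtain k where "uncountable {\<xi> \<in> UNIV. c \<xi> = k}"
    by (rule uncountable_fiber[OF uncountable_omega1, of c]) auto
  then have "infinite {\<xi>. c \<xi> = k}" using countable_finite by auto
  \<comment> \<open>The uncountable fibre is unbounded, but a countably infinite part of it lies
    below some member of \<open>S\<close>.\<close>
  from infinite_countable_subset'[OF this]
  obtain N where N: "N \<subseteq> {\<xi>. c \<xi> = k}" "countable N" "infinite N"
    by (elim exE conjE) (rule that)
  from countable_omega1_bounded[OF N(2)] obtain b where b: "\<forall>\<xi>\<in>N. \<xi> < b" by blast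
  obtain \<alpha> where \<alpha>: "\<alpha> \<in> S" "b < \<alpha>" using uncountable_omega1_unbounded[OF S] by metis
  have "N \<subseteq> {\<xi>. \<xi> \<le> ht (a \<alpha>) \<and> label (a \<alpha>) \<xi> = k}"
  proof
    fix \<xi> assume \<xi>: "\<xi> \<in> N"
    then have less: "\<xi> < \<alpha>" using b \<alpha>(2) by (meson less_trans)
    moreover have "\<alpha> \<le> ht (a \<alpha>)" using a[OF \<alpha>(1)] by simp
    ultimately have "\<xi> \<le> ht (a \<alpha>)" by simp
    moreover have "label (a \<alpha>) \<xi> = k" using c[OF \<alpha>(1) less] N(1) \<xi> by auto
    ultimately show "\<xi> \<in> {\<xi>. \<xi> \<le> ht (a \<alpha>) \<and> label (a \<alpha>) \<xi> = k}" by simp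
  qed
  moreover have "finite {\<xi>. \<xi> \<le> ht (a \<alpha>) \<and> label (a \<alpha>) \<xi> = k}"
    using a[OF \<alpha>(1)] by (intro finite_label) simp
  ultimately show False using N(3) finite_subset by blast
qed

text \<open>
  The tree of label sequences is realised on a set \<open>T\<close> of representatives in \<open>U\<close>: a node \<open>x\<close> stands
  for its sequence of labels at the levels strictly below \<open>ht x\<close>, so the label of \<open>x\<close> itself does
  not count.
\<close>

definition same :: "'a \<Rightarrow> 'a \<Rightarrow> bool" where
  "same x y \<longleftrightarrow> ht x = ht y \<and> (\<forall>\<xi><ht x. label x \<xi> = label y \<xi>)"

definition below :: "'a \<Rightarrow> 'a \<Rightarrow> bool" (infix \<open>\<prec>\<close> 50) where
  "x \<prec> y \<longleftrightarrow> ht x < ht y \<and> (\<forall>\<xi><ht x. label x \<xi> = label y \<xi>)"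

definition rep :: "'a \<Rightarrow> 'a" where
  "rep x = (SOME y. y \<in> U \<and> same x y)"

text \<open>Representatives keep the new tree in the type of \<open>U\<close>, over which
  universality is quantified.\<close>

definition T :: "'a set" where
  "T = rep ` U"

lemma rep:
  assumes "x \<in> U"
  shows rep_in: "rep x \<in> U" and same_rep: "same x (rep x)"
proof -
  have "x \<in> U \<and> same x x" using assms by (simp add: same_def)
  then have "rep x \<in> U \<and> same x (rep x)" unfolding rep_def by (rule someI)
  then show "rep x \<in> U" "same x (rep x)" by simp_all
qed

lemma ht_rep: "x \<in> U \<Longrightarrow> ht (rep x) = ht x"
  using same_rep[of x] by (simp add: same_def)

lemma label_rep: "x \<in> U \<Longrightarrow> \<xi> < ht x \<Longrightarrow> label (rep x) \<xi> = label x \<xi>"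
  using same_rep[of x] by (simp add: same_def)

lemma T_subset: "T \<subseteq> U"
  unfolding T_def using rep_in by blast

lemma T_eqI:
  assumes "x \<in> T" "y \<in> T" "same x y"
  shows "x = y"
proof -
  obtain u v where uv: "u \<in> U" "x = rep u" "v \<in> U" "y = rep v"
    using assms(1,2) unfolding T_def by blast
  have "same u x" "same v y" using same_rep uv by simp_all
  \<comment> \<open>Equivalent nodes define the same predicate, so \<open>SOME\<close> returns the
    same representative for both.\<close>
  then have "same u = same v" using assms(3) unfolding same_def fun_eq_iff by auto
  then show ?thesis using uv by (simp add: rep_def)
qed

text \<open>The restriction of \<open>x\<close> to level \<open>\<xi>\<close> in the new tree. It
  has the right labels but need not lie below \<open>x\<close> in \<open>U\<close>.\<close>

lemma rep_anc:
  assumes "x \<in> U" "\<xi> < ht x"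
  shows "rep (anc x \<xi>) \<in> T" "ht (rep (anc x \<xi>)) = \<xi>" "rep (anc x \<xi>) \<prec> x"
proof -
  have a: "anc x \<xi> \<in> U" "ht (anc x \<xi>) = \<xi>" using anc[of x \<xi>] assms by simp_all
  then show "rep (anc x \<xi>) \<in> T" and ht: "ht (rep (anc x \<xi>)) = \<xi>"
    by (simp_all add: T_def ht_rep)
  have "label (rep (anc x \<xi>)) \<eta> = label x \<eta>" if "\<eta> < \<xi>" for \<eta>
    using label_rep[OF a(1), of \<eta>] label_anc[OF assms(1), of \<eta> \<xi>] a(2) that assms(2) by simp
  with ht assms(2) show "rep (anc x \<xi>) \<prec> x" by (simp add: below_def)
qed

lemma tree_T: "tree_ht T (\<prec>) ht"
proof
  show "x \<prec> z" if "x \<prec> y" "y \<prec> z" for x y z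
    using that unfolding below_def by (auto intro: less_trans)
  show "x = y \<or> x \<prec> y \<or> y \<prec> x" if "x \<in> T" "y \<in> T" "x \<prec> z" "y \<prec> z" for x y z
  proof (cases "ht x" "ht y" rule: linorder_cases)
    case equal
    with that(3,4) have "same x y" by (simp add: same_def below_def)
    with that(1,2) show ?thesis using T_eqI by blast
  qed (use that(3,4) in \<open>auto simp: below_def intro: less_trans\<close>)
  show "ht x < ht y" if "x \<prec> y" for x y using that by (simp add: below_def)
  show "\<exists>y\<in>T. y \<prec> x \<and> ht y = \<xi>" if "x \<in> T" "\<xi> < ht x" for x \<xi>
    using rep_anc[of x \<xi>] that T_subset by blast
qed

section \<open>The label tree is a wide Aronszajn tree\<close>

lemma T_unbounded: "\<exists>x\<in>T. \<alpha> \<le> ht x"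
proof -
  obtain x where "x \<in> U" "\<alpha> \<le> ht x" using unbounded by blast
  then show ?thesis by (intro bexI[of _ "rep x"]) (simp_all add: ht_rep T_def)
qed

lemma uncountable_T: "uncountable T"
proof
  assume "countable T"
  then have "countable (ht ` T)" by (rule countable_image)
  from countable_omega1_bounded[OF this] obtain b where "\<forall>a\<in>ht ` T. a < b" by blast
  moreover obtain x where "x \<in> T" "b \<le> ht x" using T_unbounded by blast
  ultimately show False by fastforce
qed

text \<open>A chain has at most one node per height, and comparable nodes have equal labels below
  the lower one; an uncountable chain would contradict
  \<open>exists_label_disagreement\<close>.\<close>

lemma countable_chain_T:
  assumes "C \<subseteq> T" and chain: "\<forall>x\<in>C. \<forall>y\<in>C. x = y \<or> x \<prec> y \<or> y \<prec> x"
  shows "countable C"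
proof (rule ccontr)
  assume "uncountable C"
  have inj: "inj_on ht C"
  proof (rule inj_onI)
    fix x y assume "x \<in> C" "y \<in> C" "ht x = ht y"
    moreover from this have "x = y \<or> x \<prec> y \<or> y \<prec> x" using chain by blast
    ultimately show "x = y" by (auto simp: below_def)
  qed
  have "uncountable (ht ` C)"
    using \<open>uncountable C\<close> inj countable_image_inj_on by blast
  moreover have "inv_into C ht \<alpha> \<in> U \<and> \<alpha> \<le> ht (inv_into C ht \<alpha>)" if "\<alpha> \<in> ht ` C" for \<alpha>
    using inv_into_into[OF that] f_inv_into_f[OF that] assms(1) T_subset by auto
  ultimately have "\<exists>\<alpha>\<in>ht ` C. \<exists>\<beta>\<in>ht ` C. \<alpha> < \<beta> \<and>
      (\<exists>\<xi><\<alpha>. label (inv_into C ht \<alpha>) \<xi> \<noteq> label (inv_into C ht \<beta>) \<xi>)"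
    by (rule exists_label_disagreement)
  then obtain \<alpha> \<beta> \<xi> where ab: "\<alpha> \<in> ht ` C" "\<beta> \<in> ht ` C" "\<alpha> < \<beta>" "\<xi> < \<alpha>"
    and ne: "label (inv_into C ht \<alpha>) \<xi> \<noteq> label (inv_into C ht \<beta>) \<xi>" by blast
  obtain x y where xy: "x \<in> C" "y \<in> C" "\<alpha> = ht x" "\<beta> = ht y" using ab by blast
  with inj ne have ne': "label x \<xi> \<noteq> label y \<xi>" by simp
  have "x = y \<or> x \<prec> y \<or> y \<prec> x" using chain xy(1,2) by blast
  then have "x \<prec> y" using xy(3,4) ab(3) by (auto simp: below_def)
  with ne' ab(4) xy(3) show False by (simp add: below_def)
qed

lemma wide_aronszajn_T:
  assumes height: "height_omega1 U (\<sqsubset>)" and size: "|U| \<le>o cardSuc natLeq"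
  shows "wide_aronszajn T (\<prec>)"
proof -
  interpret T: tree_ht T "(\<prec>)" ht by (rule tree_T)
  have "height_omega1 T (\<prec>)"
    unfolding height_omega1_def
  proof (intro conjI ballI allI impI)
    show "countable (pred_set T (\<prec>) x)" if "x \<in> T" for x
      using T.countable_below[OF that] by (simp add: pred_set_def)
    fix W :: "nat rel" assume "Well_order W"
    then obtain x where x: "x \<in> U" "W \<le>o pred_rel U (\<sqsubset>) x"
      using height unfolding height_omega1_def by blast
    \<comment> \<open>\<open>rep\<close> preserves heights, so the new tree reaches every height
      that \<open>U\<close> reaches.\<close>
    have rx: "rep x \<in> T" using x(1) by (simp add: T_def)
    have "pred_rel T (\<prec>) (rep x) =o seg (ht x)" using T.pred_rel_seg[OF rx] ht_rep[OF x(1)] by simp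
    then have "W \<le>o pred_rel T (\<prec>) (rep x)"
      using ordLeq_ordIso_trans[OF x(2) ordIso_transitive[OF pred_rel_seg[OF x(1)] ordIso_symmetric]] by blast
    with rx show "\<exists>x\<in>T. W \<le>o pred_rel T (\<prec>) x" by blast
  qed
  moreover have "|T| =o cardSuc natLeq"
  proof -
    have "|T| \<le>o cardSuc natLeq" using card_of_mono1[OF T_subset] size by (rule ordLeq_transitive)
    moreover have "\<not> |T| \<le>o |UNIV :: nat set|"
      using uncountable_T unfolding card_of_ordLeq[symmetric] countable_def by simp
    then have "|UNIV :: nat set| <o |T|" by (simp add: not_ordLeq_iff_ordLess card_of_Well_order)
    then have "natLeq <o |T|"
      using ordIso_ordLess_trans[OF ordIso_symmetric[OF card_of_nat]] by blast
    then have "cardSuc natLeq \<le>o |T|"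
      by (simp add: cardSuc_ordLess_ordLeq natLeq_Card_order card_of_Card_order)
    ultimately show ?thesis by (simp add: ordIso_iff_ordLeq)
  qed
  moreover have "countable B" if "is_branch T (\<prec>) B" for B
    using that countable_chain_T[of B] by (simp add: is_branch_def is_chain_def)
  ultimately show ?thesis unfolding wide_aronszajn_def using T.is_tree by simp
qed

lemma no_weak_embedding:
  assumes f: "weak_embedding T (\<prec>) U (\<sqsubset>) f"
  shows False
proof -
  have fU: "f x \<in> U" if "x \<in> T" for x using f that unfolding weak_embedding_def by blast
  have fmono: "f x \<sqsubset> f y" if "x \<in> T" "y \<in> T" "x \<prec> y" for x y
    using f that unfolding weak_embedding_def by blast
  \<comment> \<open>A weak embedding may raise heights but cannot lower them: from a counterexample
    \<open>x\<close>, the restriction of \<open>x\<close> to level \<open>ht (f x)\<close> would be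
    one of smaller height.\<close>
  have ht_f: "ht x \<le> ht (f x)" if "x \<in> T" for x
    using that
  proof (induction "ht x" arbitrary: x rule: less_induct)
    case less
    show ?case
    proof (rule leI, rule notI)
      assume l: "ht (f x) < ht x"
      let ?y = "rep (anc x (ht (f x)))"
      have "x \<in> U" using less.prems T_subset by blast
      note y = rep_anc[OF this l]
      have "ht ?y < ht x" using y(2) l by simp
      from less.hyps[OF this y(1)] have "ht (f x) \<le> ht (f ?y)" using y(2) by simp
      moreover have "ht (f ?y) < ht (f x)"
        using fmono[OF y(1) less.prems y(3)] fU y(1) less.prems by (intro ht_less) simp_all
      ultimately show False by simp
    qed
  qed
  have "\<forall>\<alpha>. \<exists>x. x \<in> T \<and> \<alpha> \<le> ht x" using T_unbounded by blast
  from choice[OF this] obtain t where t: "\<And>\<alpha>. t \<alpha> \<in> T" "\<And>\<alpha>. \<alpha> \<le> ht (t \<alpha>)" by blast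
  have tU: "t \<alpha> \<in> U" for \<alpha> using t(1) T_subset by blast
  have ftU: "f (t \<alpha>) \<in> U" for \<alpha> using t(1) fU by blast
  have ht_ft: "\<alpha> \<le> ht (f (t \<alpha>))" for \<alpha> using t(2) ht_f[OF t(1)] by (rule order_trans)
  \<comment> \<open>Both nodes reach level \<open>\<alpha>\<close>, so coherence makes
    \<open>d \<alpha>\<close> finite.\<close>
  define d where "d \<alpha> = {\<xi>. \<xi> < \<alpha> \<and> label (t \<alpha>) \<xi> \<noteq> label (f (t \<alpha>)) \<xi>}" for \<alpha>
  have fin_d: "finite (d \<alpha>)" for \<alpha>
  proof (rule finite_subset)
    show "d \<alpha> \<subseteq> {\<xi>. \<xi> \<le> ht (t \<alpha>) \<and> \<xi> \<le> ht (f (t \<alpha>)) \<and> label (t \<alpha>) \<xi> \<noteq> label (f (t \<alpha>)) \<xi>}"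
      using t(2)[of \<alpha>] ht_ft[of \<alpha>] by (auto simp: d_def)
  qed (rule finite_disagreement[OF tU ftU])
  \<comment> \<open>The least ordinal keeps the maximum below defined when \<open>d \<alpha>\<close>
    is empty.\<close>
  define z where "z = (LEAST \<xi> :: omega1. True)"
  have "Max (insert z (d \<alpha>)) < \<alpha>" if "z < \<alpha>" for \<alpha>
    using fin_d that by (simp add: d_def)
  from pressing_down[OF this] obtain \<gamma> where \<gamma>: "uncountable {\<alpha>. Max (insert z (d \<alpha>)) = \<gamma>}" by blast
  have low: "\<xi> \<le> \<gamma>" if "Max (insert z (d \<alpha>)) = \<gamma>" "\<xi> \<in> d \<alpha>" for \<alpha> \<xi>
    using Max_ge[of "insert z (d \<alpha>)" \<xi>] fin_d that by simp
  \<comment> \<open>Removing the ordinals up to \<open>\<gamma>\<close> ensures that every remaining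
    \<open>t \<alpha>\<close> reaches level \<open>\<gamma>\<close>.\<close>
  define S where "S = {\<alpha>. Max (insert z (d \<alpha>)) = \<gamma>} - {..\<gamma>}"
  have S: "uncountable S"
    unfolding S_def by (rule uncountable_minus_countable[OF \<gamma> countable_atMost_omega1])
  obtain \<alpha>\<^sub>0 where \<alpha>\<^sub>0: "\<alpha>\<^sub>0 \<in> S" using uncountable_omega1_unbounded[OF S] by metis
  \<comment> \<open>Up to \<open>\<gamma>\<close> the labels of \<open>t \<alpha>\<close> are coded
    by their finite difference from one fixed sequence. There are countably many codes, and equal
    codes mean equal labels up to \<open>\<gamma>\<close>.\<close>
  define D where "D \<alpha> = {(\<xi>, k). \<xi> \<le> \<gamma> \<and> label (t \<alpha>) \<xi> = k \<and> label (t \<alpha>\<^sub>0) \<xi> \<noteq> k}" for \<alpha>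
  have "countable (D ` S)"
  proof (rule countable_subset)
    show "countable (Fpow ({..\<gamma>} \<times> (UNIV :: nat set)))"
      by (intro countable_Fpow countable_SIGMA countable_atMost_omega1) simp
    show "D ` S \<subseteq> Fpow ({..\<gamma>} \<times> UNIV)"
    proof (rule image_subsetI)
      fix \<alpha> assume "\<alpha> \<in> S"
      then have "\<gamma> \<le> ht (t \<alpha>)" "\<gamma> \<le> ht (t \<alpha>\<^sub>0)"
        using \<alpha>\<^sub>0 t(2)[of \<alpha>] t(2)[of \<alpha>\<^sub>0] by (auto simp: S_def)
      then have "D \<alpha> \<subseteq> (\<lambda>\<xi>. (\<xi>, label (t \<alpha>) \<xi>)) `
          {\<xi>. \<xi> \<le> ht (t \<alpha>) \<and> \<xi> \<le> ht (t \<alpha>\<^sub>0) \<and> label (t \<alpha>) \<xi> \<noteq> label (t \<alpha>\<^sub>0) \<xi>}"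
        by (auto simp: D_def)
      then have "finite (D \<alpha>)"
        by (rule finite_subset) (intro finite_imageI finite_disagreement tU)
      then show "D \<alpha> \<in> Fpow ({..\<gamma>} \<times> UNIV)" by (auto simp: Fpow_def D_def)
    qed
  qed
  then obtain E where E: "uncountable {\<alpha> \<in> S. D \<alpha> = E}"
    by (rule uncountable_fiber[OF S])
  define S' where "S' = {\<alpha> \<in> S. D \<alpha> = E}"
  have agree_low: "label (t \<alpha>) \<xi> = label (t \<beta>) \<xi>" if "\<alpha> \<in> S'" "\<beta> \<in> S'" "\<xi> \<le> \<gamma>" for \<alpha> \<beta> \<xi>
  proof -
    have "(\<xi>, k) \<in> D \<alpha> \<longleftrightarrow> (\<xi>, k) \<in> D \<beta>" for k using that by (simp add: S'_def)
    from this[of "label (t \<alpha>) \<xi>"] this[of "label (t \<beta>) \<xi>"] that(3) show ?thesis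
      by (auto simp: D_def)
  qed
  have "uncountable S'" using E by (simp add: S'_def)
  from exists_label_disagreement[OF this, of t] tU t(2) obtain \<alpha> \<beta>
    where ab: "\<alpha> \<in> S'" "\<beta> \<in> S'" "\<alpha> < \<beta>" and ex: "\<exists>\<xi><\<alpha>. label (t \<alpha>) \<xi> \<noteq> label (t \<beta>) \<xi>" by blast
  define \<delta> where "\<delta> = (LEAST \<xi>. \<xi> < \<alpha> \<and> label (t \<alpha>) \<xi> \<noteq> label (t \<beta>) \<xi>)"
  have \<delta>: "\<delta> < \<alpha>" "label (t \<alpha>) \<delta> \<noteq> label (t \<beta>) \<delta>"
    using LeastI_ex[OF ex] by (simp_all add: \<delta>_def)
  have least: "label (t \<alpha>) \<xi> = label (t \<beta>) \<xi>" if "\<xi> < \<delta>" for \<xi>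
    using not_less_Least[of \<xi> "\<lambda>\<xi>. \<xi> < \<alpha> \<and> label (t \<alpha>) \<xi> \<noteq> label (t \<beta>) \<xi>"] that \<delta>(1)
    by (auto simp: \<delta>_def)
  have "\<delta> > \<gamma>" using agree_low[OF ab(1,2), of \<delta>] \<delta>(2) by (meson not_le)
  have dht: "\<delta> < ht (t \<alpha>)" "\<delta> < ht (t \<beta>)"
    using \<delta>(1) ab(3) t(2)[of \<alpha>] t(2)[of \<beta>] by simp_all
  \<comment> \<open>The part shared by \<open>t \<alpha>\<close> and \<open>t \<beta>\<close>. It
    records labels strictly below \<open>\<delta>\<close> only, yet its image has height at least
    \<open>\<delta>\<close> and so fixes the label of both larger images at \<open>\<delta>\<close>
    itself.\<close>
  let ?s = "rep (anc (t \<alpha>) \<delta>)"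
  note s = rep_anc[OF tU dht(1)]
  have "?s \<prec> t \<beta>" using s(2,3) least dht(2) by (simp add: below_def)
  then have fs: "f ?s \<sqsubset> f (t \<alpha>)" "f ?s \<sqsubset> f (t \<beta>)" using fmono s(1,3) t(1) by blast+
  have "\<delta> \<le> ht (f ?s)" using ht_f[OF s(1)] s(2) by simp
  have common: "label (f (t \<epsilon>)) \<delta> = label (f ?s) \<delta>" if "f ?s \<sqsubset> f (t \<epsilon>)" for \<epsilon>
  proof -
    have "anc (f (t \<epsilon>)) (ht (f ?s)) = f ?s" using that by (intro anc_eqI ftU fU s(1)) simp
    moreover have "ht (f ?s) \<le> ht (f (t \<epsilon>))"
      using ht_less[OF fU[OF s(1)] ftU that] by simp
    ultimately show ?thesis using label_anc[OF ftU \<open>\<delta> \<le> ht (f ?s)\<close>] by metis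
  qed
  have high: "label (t \<epsilon>) \<delta> = label (f (t \<epsilon>)) \<delta>" if "\<epsilon> \<in> S'" "\<delta> < \<epsilon>" for \<epsilon>
  proof (rule ccontr)
    assume "\<not> ?thesis"
    then have "\<delta> \<in> d \<epsilon>" using that(2) by (simp add: d_def)
    moreover have "Max (insert z (d \<epsilon>)) = \<gamma>" using that(1) by (simp add: S'_def S_def)
    ultimately have "\<delta> \<le> \<gamma>" using low by blast
    with \<open>\<delta> > \<gamma>\<close> show False by simp
  qed
  have "\<delta> < \<beta>" using \<delta>(1) ab(3) by (rule less_trans)
  with high[OF ab(1) \<delta>(1)] high[OF ab(2)] common[OF fs(1)] common[OF fs(2)] \<delta>(2) show False by simp
qed

end

text \<open>\<open>wide_aronszajn\<close> bounds maximal chains; by Zorn's lemma every chain extends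
  to one.\<close>

lemma wide_aronszajn_no_uncountable_chain:
  assumes "wide_aronszajn U lt" "tree_ht U lt ht"
  shows "tree_ht.no_uncountable_chain U lt"
  unfolding tree_ht.no_uncountable_chain_def[OF assms(2)]
proof (intro allI impI)
  fix C assume "C \<subseteq> U" "\<forall>x\<in>C. \<forall>y\<in>C. x = y \<or> lt x y \<or> lt y x"
  then have C: "is_chain U lt C" by (simp add: is_chain_def)
  let ?A = "{D. is_chain U lt D \<and> C \<subseteq> D}"
  have "\<exists>M\<in>?A. \<forall>X\<in>?A. M \<subseteq> X \<longrightarrow> X = M"
  proof (rule subset_Zorn_nonempty)
    show "?A \<noteq> {}" using C by blast
    fix K assume K: "K \<noteq> {}" "subset.chain ?A K"
    have KA: "K \<subseteq> ?A" and total: "\<forall>X\<in>K. \<forall>Y\<in>K. X \<subseteq> Y \<or> Y \<subseteq> X"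
      using K(2) by (simp_all add: subset_chain_def)
    have "X \<subseteq> U" "C \<subseteq> X" if "X \<in> K" for X using KA that by (auto simp: is_chain_def)
    then have "\<Union>K \<subseteq> U" "C \<subseteq> \<Union>K" using K(1) by blast+
    moreover have "x = y \<or> lt x y \<or> lt y x" if xy: "x \<in> \<Union>K" "y \<in> \<Union>K" for x y
    proof -
      from xy obtain X Y where XY: "X \<in> K" "Y \<in> K" "x \<in> X" "y \<in> Y" by blast
      then have "X \<subseteq> Y \<or> Y \<subseteq> X" using total by simp
      with XY obtain Z where Z: "Z \<in> K" "x \<in> Z" "y \<in> Z" by blast
      then have "is_chain U lt Z" using KA by blast
      with Z(2,3) show ?thesis unfolding is_chain_def by simp
    qed
    ultimately show "\<Union>K \<in> ?A" by (simp add: is_chain_def)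
  qed
  then obtain M where M: "M \<in> ?A" and max: "\<forall>X\<in>?A. M \<subseteq> X \<longrightarrow> X = M" by (elim bexE)
  have "is_branch U lt M"
    unfolding is_branch_def
  proof (intro conjI allI impI)
    show "is_chain U lt M" using M by simp
    fix X assume X: "is_chain U lt X" "M \<subseteq> X"
    moreover have "C \<subseteq> X" using M X(2) by auto
    ultimately show "X = M" using max by simp
  qed
  then have "countable M" using assms(1) unfolding wide_aronszajn_def by simp
  then show "countable C" using M by (auto intro: countable_subset)
qed

theorem theorem6p1:
  assumes "MA_omega1 TYPE('a)"
  shows "\<not> (\<exists>(U :: 'a set) ltU. wide_aronszajn U ltU \<and>
            (\<forall>(T :: 'a set) lt. wide_aronszajn T lt \<longrightarrow>
               (\<exists>f. weak_embedding T lt U ltU f)))"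
proof (intro notI, elim exE conjE)
  fix U :: "'a set" and ltU
  assume U: "wide_aronszajn U ltU"
    and universal: "\<forall>(T :: 'a set) lt. wide_aronszajn T lt \<longrightarrow> (\<exists>f. weak_embedding T lt U ltU f)"
  have tree: "is_tree U ltU" and height: "height_omega1 U ltU" and card: "|U| =o cardSuc natLeq"
    using U unfolding wide_aronszajn_def by simp_all
  have size: "|U| \<le>o cardSuc natLeq" using card by (rule ordIso_imp_ordLeq)
  have "infinite U"
  proof -
    have "natLeq \<le>o |U|"
      using cardSuc_ordLeq[OF natLeq_Card_order] ordIso_symmetric[OF card] by (rule ordLeq_ordIso_trans)
    then show ?thesis
      using ordIso_ordLeq_trans[OF card_of_nat] infinite_iff_card_of_nat by blast
  qed
  obtain ht where ht: "tree_ht U ltU ht"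
    using ex_height[OF tree] height unfolding height_omega1_def by blast
  interpret tree_ht U ltU ht by (rule ht)
  obtain F where "coherent_labelling F"
    using ex_coherent_labelling[OF assms wide_aronszajn_no_uncountable_chain[OF U ht] \<open>infinite U\<close> size]
    by blast
  then interpret labelled_tree U ltU ht F
    by unfold_locales (assumption, rule ht_unbounded[OF height])
  obtain f where "weak_embedding T below U ltU f"
    using universal wide_aronszajn_T[OF height size] by blast
  then show False by (rule no_weak_embedding)
qed

end
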